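(* Let $\mathcal H$ be an abelian category in which subobjects of projective objects are projective, and let $\mathcal T$ be a covariantly finite full additive subcategory of $\mathcal H$ consisting of projective objects and closed under direct summands. The following assertions are equivalent: 1) The stable category $\underline{\mathcal H}$ of $\mathcal H$ associated to $\mathcal T$ is balanced. 2) $^\perp\mathcal T$ is closed under subobjects. 3) The pair $(^\perp\mathcal T,\mathrm{Sub}(\mathcal T))$ is a hereditary (split) torsion pair in $\mathcal H$. When $\mathcal T$ is contravariantly finite in $\mathcal H$, assertions 1), 2) and 3) are equivalent to: 4) $\underline{\mathcal H}$ is weakly balanced. When $\mathcal H$ has enough injectives, assertions 1), 2) and 3) are also equivalent to: 5) For every object $T\in\mathcal T$, there is a monomorphism $T\to E$, where $E$ is an injective(-projective) object of $\mathcal H$ which belongs to $\mathcal T$.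
   Context: $^\perp\mathcal T$ is the full subcategory of objects $M$ with $\mathcal H(M,T)=0$ for all $T\in\mathcal T$; $\mathrm{Sub}(\mathcal T)$ is the full subcategory of subobjects of objects of $\mathcal T$. A torsion pair on an abelian category is a pair $(\mathcal X,\mathcal Y)$ of full subcategories closed under isomorphisms with $\mathrm{Hom}(X,Y)=0$ for $X\in\mathcal X,Y\in\mathcal Y$ and such that each $M$ lies in a short exact sequence $0\to M_{\mathcal X}\to M\to M^{\mathcal Y}\to 0$ with $M_{\mathcal X}\in\mathcal X$, $M^{\mathcal Y}\in\mathcal Y$; it is hereditary if $\mathcal X$ is closed under subobjects and split if these sequences all split. (In 3) splitting is automatic because the objects of $\mathrm{Sub}(\mathcal T)$ are projective; in 5) projectivity of $E$ is automatic because $\mathcal T$ consists of projectives.) The stable category $\underline{\mathcal H}$ is the quotient of $\mathcal H$ by the ideal of morphisms factoring through an object of $\mathcal T$; $\overline f$ denotes the class of $f$. A category is balanced if every morphism that is both a monomorphism and an epimorphism is an isomorphism. A $\mathcal T$-preenvelope of $M$ is a morphism $M\to T^M$ with $T^M\in\mathcal T$ such that $\mathcal H(T^M,T)\to\mathcal H(M,T)$ is surjective for all $T\in\mathcal T$; a $\mathcal T$-precover $T_M\to M$ is the dual notion. $\mathcal T$ is covariantly (resp. contravariantly) finite if every object has a $\mathcal T$-preenvelope (resp. $\mathcal T$-precover). If $\mathcal T$ is both covariantly and contravariantly finite, $\underline{\mathcal H}$ is pretriangulated: fix for each $M$ a right exact sequence $M\xrightarrow{i_M}T^M\to\Sigma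 M\to 0$ with $i_M$ a $\mathcal T$-preenvelope; for $f:L\to M$, the pushout of $i_L$ and $f$ gives $g:M\to N$, and, with the induced $h:N\to\Sigma L$ (vanishing on $M$ and agreeing with $T^L\to\Sigma L$ on $T^L$), a sequence $L\xrightarrow{\overline f}M\xrightarrow{\overline g}N\xrightarrow{\overline h}\Sigma L$; the right triangles are the sequences isomorphic in $\underline{\mathcal H}$ to these. Left triangles $\Omega N\to L\to M\to N$ are defined dually with precovers, kernels and pullbacks. $\underline{\mathcal H}$ is weakly balanced if a morphism $\alpha:M\to N$ of $\underline{\mathcal H}$ is an isomorphism whenever there exist a left triangle $\Omega N\to 0\to M\xrightarrow{\alpha}N$ and a right triangle $M\xrightarrow{\alpha}N\to 0\to\Sigma M$. *)

theory Defs
  imports "HOL-Algebra.Group"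
begin

section \<open>Categories and abelian categories\<close>

text \<open>
  A single record carries a category together with an addition of parallel arrows; domain and
  codomain are determined by the arrow, and \<open>g \<cdot>\<^bsub>C\<^esub> f\<close> is \<open>g\<close> after \<open>f\<close>.
  Full subcategories are represented by their sets of objects.
\<close>

record ('o, 'm) cat =
  Obj :: "'o set"
  Arr :: "'m set"
  Dom :: "'m \<Rightarrow> 'o"
  Cod :: "'m \<Rightarrow> 'o"
  Ident :: "'o \<Rightarrow> 'm"
  Comp :: "'m \<Rightarrow> 'm \<Rightarrow> 'm" (infixr \<open>\<cdot>\<index>\<close> 70)
  Plus :: "'m \<Rightarrow> 'm \<Rightarrow> 'm"
  Zero :: "'o \<Rightarrow> 'o \<Rightarrow> 'm"

definition Hom :: "('o, 'm) cat \<Rightarrow> 'o \<Rightarrow> 'o \<Rightarrow> 'm set" where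
  "Hom C X Y = {f \<in> Arr C. Dom C f = X \<and> Cod C f = Y}"

definition hom_group :: "('o, 'm) cat \<Rightarrow> 'o \<Rightarrow> 'o \<Rightarrow> 'm monoid" where
  "hom_group C X Y = \<lparr>carrier = Hom C X Y, monoid.mult = Plus C, one = Zero C X Y\<rparr>"

definition Diff :: "('o, 'm) cat \<Rightarrow> 'm \<Rightarrow> 'm \<Rightarrow> 'm" where
  "Diff C f g = Plus C f (inv\<^bsub>hom_group C (Dom C f) (Cod C f)\<^esub> g)"

definition opposite :: "('o, 'm) cat \<Rightarrow> ('o, 'm) cat" where
  "opposite C = \<lparr>Obj = Obj C, Arr = Arr C, Dom = Cod C, Cod = Dom C, Ident = Ident C,
     Comp = (\<lambda>g f. f \<cdot>\<^bsub>C\<^esub> g), Plus = Plus C, Zero = (\<lambda>X Y. Zero C Y X)\<rparr>"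

locale category =
  fixes C :: "('o, 'm) cat" (structure)
  assumes Dom_in_Obj: "f \<in> Arr C \<Longrightarrow> Dom C f \<in> Obj C"
    and Cod_in_Obj: "f \<in> Arr C \<Longrightarrow> Cod C f \<in> Obj C"
    and Ident_in_Hom: "X \<in> Obj C \<Longrightarrow> Ident C X \<in> Hom C X X"
    and Comp_in_Hom: "f \<in> Hom C X Y \<Longrightarrow> g \<in> Hom C Y Z \<Longrightarrow> g \<cdot> f \<in> Hom C X Z"
    and Comp_Ident: "f \<in> Hom C X Y \<Longrightarrow> f \<cdot> Ident C X = f"
    and Ident_Comp: "f \<in> Hom C X Y \<Longrightarrow> Ident C Y \<cdot> f = f"
    and Comp_assoc: "f \<in> Hom C W X \<Longrightarrow> g \<in> Hom C X Y \<Longrightarrow> h \<in> Hom C Y Z \<Longrightarrow>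
      (h \<cdot> g) \<cdot> f = h \<cdot> (g \<cdot> f)"

locale preadditive_category = category +
  assumes hom_comm_group: "X \<in> Obj C \<Longrightarrow> Y \<in> Obj C \<Longrightarrow> comm_group (hom_group C X Y)"
    and Comp_Plus: "f \<in> Hom C X Y \<Longrightarrow> g \<in> Hom C Y Z \<Longrightarrow> g' \<in> Hom C Y Z \<Longrightarrow>
      Plus C g g' \<cdot> f = Plus C (g \<cdot> f) (g' \<cdot> f)"
    and Plus_Comp: "f \<in> Hom C X Y \<Longrightarrow> f' \<in> Hom C X Y \<Longrightarrow> g \<in> Hom C Y Z \<Longrightarrow>
      g \<cdot> Plus C f f' = Plus C (g \<cdot> f) (g \<cdot> f')"

definition monic :: "('o, 'm) cat \<Rightarrow> 'm \<Rightarrow> bool" where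
  "monic C m \<longleftrightarrow> m \<in> Arr C \<and>
     (\<forall>W. \<forall>u \<in> Hom C W (Dom C m). \<forall>v \<in> Hom C W (Dom C m).
        m \<cdot>\<^bsub>C\<^esub> u = m \<cdot>\<^bsub>C\<^esub> v \<longrightarrow> u = v)"

definition epic :: "('o, 'm) cat \<Rightarrow> 'm \<Rightarrow> bool" where
  "epic C e \<longleftrightarrow> e \<in> Arr C \<and>
     (\<forall>W. \<forall>u \<in> Hom C (Cod C e) W. \<forall>v \<in> Hom C (Cod C e) W.
        u \<cdot>\<^bsub>C\<^esub> e = v \<cdot>\<^bsub>C\<^esub> e \<longrightarrow> u = v)"

definition iso_arr :: "('o, 'm) cat \<Rightarrow> 'm \<Rightarrow> bool" where
  "iso_arr C f \<longleftrightarrow> f \<in> Arr C \<and>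
     (\<exists>g \<in> Hom C (Cod C f) (Dom C f).
        g \<cdot>\<^bsub>C\<^esub> f = Ident C (Dom C f) \<and> f \<cdot>\<^bsub>C\<^esub> g = Ident C (Cod C f))"

definition balanced :: "('o, 'm) cat \<Rightarrow> bool" where
  "balanced C \<longleftrightarrow> (\<forall>f. monic C f \<and> epic C f \<longrightarrow> iso_arr C f)"

definition zero_object :: "('o, 'm) cat \<Rightarrow> 'o \<Rightarrow> bool" where
  "zero_object C Z \<longleftrightarrow> Z \<in> Obj C \<and>
     (\<forall>X \<in> Obj C. (\<exists>!f. f \<in> Hom C X Z) \<and> (\<exists>!f. f \<in> Hom C Z X))"

definition biproduct ::
    "('o, 'm) cat \<Rightarrow> 'o \<Rightarrow> 'o \<Rightarrow> 'o \<Rightarrow> 'm \<Rightarrow> 'm \<Rightarrow> 'm \<Rightarrow> 'm \<Rightarrow> bool" where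
  "biproduct C X Y Z i\<^sub>1 i\<^sub>2 p\<^sub>1 p\<^sub>2 \<longleftrightarrow>
     i\<^sub>1 \<in> Hom C X Z \<and> i\<^sub>2 \<in> Hom C Y Z \<and> p\<^sub>1 \<in> Hom C Z X \<and> p\<^sub>2 \<in> Hom C Z Y \<and>
     p\<^sub>1 \<cdot>\<^bsub>C\<^esub> i\<^sub>1 = Ident C X \<and> p\<^sub>2 \<cdot>\<^bsub>C\<^esub> i\<^sub>2 = Ident C Y \<and>
     p\<^sub>1 \<cdot>\<^bsub>C\<^esub> i\<^sub>2 = Zero C Y X \<and> p\<^sub>2 \<cdot>\<^bsub>C\<^esub> i\<^sub>1 = Zero C X Y \<and>
     Plus C (i\<^sub>1 \<cdot>\<^bsub>C\<^esub> p\<^sub>1) (i\<^sub>2 \<cdot>\<^bsub>C\<^esub> p\<^sub>2) = Ident C Z"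

definition is_direct_sum :: "('o, 'm) cat \<Rightarrow> 'o \<Rightarrow> 'o \<Rightarrow> 'o \<Rightarrow> bool" where
  "is_direct_sum C X Y Z \<longleftrightarrow> X \<in> Obj C \<and> Y \<in> Obj C \<and> Z \<in> Obj C \<and>
     (\<exists>i\<^sub>1 i\<^sub>2 p\<^sub>1 p\<^sub>2. biproduct C X Y Z i\<^sub>1 i\<^sub>2 p\<^sub>1 p\<^sub>2)"

definition is_kernel :: "('o, 'm) cat \<Rightarrow> 'm \<Rightarrow> 'm \<Rightarrow> bool" where
  "is_kernel C f k \<longleftrightarrow> f \<in> Arr C \<and> k \<in> Arr C \<and> Cod C k = Dom C f \<and>
     f \<cdot>\<^bsub>C\<^esub> k = Zero C (Dom C k) (Cod C f) \<and>
     (\<forall>W. \<forall>x \<in> Hom C W (Dom C f). f \<cdot>\<^bsub>C\<^esub> x = Zero C W (Cod C f) \<longrightarrow>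
        (\<exists>!y. y \<in> Hom C W (Dom C k) \<and> k \<cdot>\<^bsub>C\<^esub> y = x))"

definition is_cokernel :: "('o, 'm) cat \<Rightarrow> 'm \<Rightarrow> 'm \<Rightarrow> bool" where
  "is_cokernel C f c \<longleftrightarrow> f \<in> Arr C \<and> c \<in> Arr C \<and> Dom C c = Cod C f \<and>
     c \<cdot>\<^bsub>C\<^esub> f = Zero C (Dom C f) (Cod C c) \<and>
     (\<forall>W. \<forall>x \<in> Hom C (Cod C f) W. x \<cdot>\<^bsub>C\<^esub> f = Zero C (Dom C f) W \<longrightarrow>
        (\<exists>!y. y \<in> Hom C (Cod C c) W \<and> y \<cdot>\<^bsub>C\<^esub> c = x))"

definition is_pushout :: "('o, 'm) cat \<Rightarrow> 'm \<Rightarrow> 'm \<Rightarrow> 'm \<Rightarrow> 'm \<Rightarrow> bool" where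
  "is_pushout C u v p q \<longleftrightarrow> {u, v, p, q} \<subseteq> Arr C \<and>
     Dom C u = Dom C v \<and> Dom C p = Cod C u \<and> Dom C q = Cod C v \<and> Cod C p = Cod C q \<and>
     p \<cdot>\<^bsub>C\<^esub> u = q \<cdot>\<^bsub>C\<^esub> v \<and>
     (\<forall>W. \<forall>x \<in> Hom C (Cod C u) W. \<forall>y \<in> Hom C (Cod C v) W.
        x \<cdot>\<^bsub>C\<^esub> u = y \<cdot>\<^bsub>C\<^esub> v \<longrightarrow>
        (\<exists>!z. z \<in> Hom C (Cod C p) W \<and> z \<cdot>\<^bsub>C\<^esub> p = x \<and> z \<cdot>\<^bsub>C\<^esub> q = y))"

locale abelian_category = preadditive_category +
  assumes zero_object_exists: "\<exists>Z. zero_object C Z"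
    and direct_sum_exists: "X \<in> Obj C \<Longrightarrow> Y \<in> Obj C \<Longrightarrow> \<exists>Z. is_direct_sum C X Y Z"
    and kernel_exists: "f \<in> Arr C \<Longrightarrow> \<exists>k. is_kernel C f k"
    and cokernel_exists: "f \<in> Arr C \<Longrightarrow> \<exists>c. is_cokernel C f c"
    and monic_is_kernel: "monic C m \<Longrightarrow> \<exists>f. is_kernel C f m"
    and epic_is_cokernel: "epic C e \<Longrightarrow> \<exists>f. is_cokernel C f e"

definition projective :: "('o, 'm) cat \<Rightarrow> 'o \<Rightarrow> bool" where
  "projective C P \<longleftrightarrow> P \<in> Obj C \<and>
     (\<forall>e. epic C e \<longrightarrow> (\<forall>f \<in> Hom C P (Cod C e). \<exists>g \<in> Hom C P (Dom C e). e \<cdot>\<^bsub>C\<^esub> g = f))"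

definition injective :: "('o, 'm) cat \<Rightarrow> 'o \<Rightarrow> bool" where
  "injective C E \<longleftrightarrow> E \<in> Obj C \<and>
     (\<forall>m. monic C m \<longrightarrow> (\<forall>f \<in> Hom C (Dom C m) E. \<exists>g \<in> Hom C (Cod C m) E. g \<cdot>\<^bsub>C\<^esub> m = f))"

definition subobject :: "('o, 'm) cat \<Rightarrow> 'o \<Rightarrow> 'o \<Rightarrow> bool" where
  "subobject C X Y \<longleftrightarrow> (\<exists>m \<in> Hom C X Y. monic C m)"

definition closed_under_subobjects :: "('o, 'm) cat \<Rightarrow> 'o set \<Rightarrow> bool" where
  "closed_under_subobjects C A \<longleftrightarrow> (\<forall>Y \<in> A. \<forall>X. subobject C X Y \<longrightarrow> X \<in> A)"

definition closed_under_iso :: "('o, 'm) cat \<Rightarrow> 'o set \<Rightarrow> bool" where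
  "closed_under_iso C A \<longleftrightarrow> (\<forall>f. iso_arr C f \<and> Dom C f \<in> A \<longrightarrow> Cod C f \<in> A)"

definition enough_injectives :: "('o, 'm) cat \<Rightarrow> bool" where
  "enough_injectives C \<longleftrightarrow> (\<forall>X \<in> Obj C. \<exists>E. injective C E \<and> subobject C X E)"


section \<open>Subcategories and torsion pairs\<close>

definition additive_subcategory :: "('o, 'm) cat \<Rightarrow> 'o set \<Rightarrow> bool" where
  "additive_subcategory C T \<longleftrightarrow> T \<subseteq> Obj C \<and> (\<exists>Z \<in> T. zero_object C Z) \<and>
     (\<forall>X \<in> T. \<forall>Y \<in> T. \<exists>Z \<in> T. is_direct_sum C X Y Z)"

definition closed_under_summands :: "('o, 'm) cat \<Rightarrow> 'o set \<Rightarrow> bool" where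
  "closed_under_summands C T \<longleftrightarrow> (\<forall>Z \<in> T. \<forall>X Y. is_direct_sum C X Y Z \<longrightarrow> X \<in> T)"

definition preenvelope :: "('o, 'm) cat \<Rightarrow> 'o set \<Rightarrow> 'o \<Rightarrow> 'm \<Rightarrow> bool" where
  "preenvelope C T M i \<longleftrightarrow> i \<in> Arr C \<and> Dom C i = M \<and> Cod C i \<in> T \<and>
     (\<forall>X \<in> T. \<forall>f \<in> Hom C M X. \<exists>g \<in> Hom C (Cod C i) X. g \<cdot>\<^bsub>C\<^esub> i = f)"

definition precover :: "('o, 'm) cat \<Rightarrow> 'o set \<Rightarrow> 'o \<Rightarrow> 'm \<Rightarrow> bool" where
  "precover C T M p \<longleftrightarrow> p \<in> Arr C \<and> Cod C p = M \<and> Dom C p \<in> T \<and>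
     (\<forall>X \<in> T. \<forall>f \<in> Hom C X M. \<exists>g \<in> Hom C X (Dom C p). p \<cdot>\<^bsub>C\<^esub> g = f)"

definition covariantly_finite :: "('o, 'm) cat \<Rightarrow> 'o set \<Rightarrow> bool" where
  "covariantly_finite C T \<longleftrightarrow> (\<forall>M \<in> Obj C. \<exists>i. preenvelope C T M i)"

definition contravariantly_finite :: "('o, 'm) cat \<Rightarrow> 'o set \<Rightarrow> bool" where
  "contravariantly_finite C T \<longleftrightarrow> (\<forall>M \<in> Obj C. \<exists>p. precover C T M p)"

definition left_perp :: "('o, 'm) cat \<Rightarrow> 'o set \<Rightarrow> 'o set" where
  "left_perp C T = {M \<in> Obj C. \<forall>X \<in> T. Hom C M X = {Zero C M X}}"

definition Sub :: "('o, 'm) cat \<Rightarrow> 'o set \<Rightarrow> 'o set" where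
  "Sub C T = {M \<in> Obj C. \<exists>X \<in> T. subobject C M X}"

definition short_exact :: "('o, 'm) cat \<Rightarrow> 'm \<Rightarrow> 'm \<Rightarrow> bool" where
  "short_exact C f g \<longleftrightarrow> is_kernel C g f \<and> is_cokernel C f g"

definition torsion_pair :: "('o, 'm) cat \<Rightarrow> 'o set \<Rightarrow> 'o set \<Rightarrow> bool" where
  "torsion_pair C X Y \<longleftrightarrow> X \<subseteq> Obj C \<and> Y \<subseteq> Obj C \<and>
     closed_under_iso C X \<and> closed_under_iso C Y \<and>
     (\<forall>A \<in> X. \<forall>B \<in> Y. Hom C A B = {Zero C A B}) \<and>
     (\<forall>M \<in> Obj C. \<exists>f g. short_exact C f g \<and> Cod C f = M \<and> Dom C f \<in> X \<and> Cod C g \<in> Y)"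

definition hereditary_torsion_pair :: "('o, 'm) cat \<Rightarrow> 'o set \<Rightarrow> 'o set \<Rightarrow> bool" where
  "hereditary_torsion_pair C X Y \<longleftrightarrow> torsion_pair C X Y \<and> closed_under_subobjects C X"

definition split_torsion_pair :: "('o, 'm) cat \<Rightarrow> 'o set \<Rightarrow> 'o set \<Rightarrow> bool" where
  "split_torsion_pair C X Y \<longleftrightarrow> torsion_pair C X Y \<and>
     (\<forall>f g. short_exact C f g \<and> Dom C f \<in> X \<and> Cod C g \<in> Y \<longrightarrow>
        (\<exists>r \<in> Hom C (Cod C f) (Dom C f). r \<cdot>\<^bsub>C\<^esub> f = Ident C (Dom C f)))"


section \<open>The stable category\<close>

definition factors_through :: "('o, 'm) cat \<Rightarrow> 'o set \<Rightarrow> 'm \<Rightarrow> bool" where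
  "factors_through C T f \<longleftrightarrow>
     (\<exists>X \<in> T. \<exists>u \<in> Hom C (Dom C f) X. \<exists>v \<in> Hom C X (Cod C f). f = v \<cdot>\<^bsub>C\<^esub> u)"

definition stable_class :: "('o, 'm) cat \<Rightarrow> 'o set \<Rightarrow> 'm \<Rightarrow> 'm set" where
  "stable_class C T f = {g \<in> Hom C (Dom C f) (Cod C f). factors_through C T (Diff C f g)}"

text \<open>
  The arrows are the classes themselves.  All members of a class have the same domain and codomain,
  and the operations do not depend on the representatives.
\<close>

definition stable_category :: "('o, 'm) cat \<Rightarrow> 'o set \<Rightarrow> ('o, 'm set) cat" where
  "stable_category C T =
     (let rep = (\<lambda>a :: 'm set. SOME f. f \<in> a) in
      \<lparr>Obj = Obj C,
       Arr = stable_class C T ` Arr C,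
       Dom = (\<lambda>a. Dom C (rep a)),
       Cod = (\<lambda>a. Cod C (rep a)),
       Ident = (\<lambda>X. stable_class C T (Ident C X)),
       Comp = (\<lambda>b a. stable_class C T (rep b \<cdot>\<^bsub>C\<^esub> rep a)),
       Plus = (\<lambda>a b. stable_class C T (Plus C (rep a) (rep b))),
       Zero = (\<lambda>X Y. stable_class C T (Zero C X Y))\<rparr>)"


section \<open>Right and left triangles in the stable category\<close>

text \<open>
  The fixed right exact sequences \<open>M \<rightarrow> T\<^sup>M \<rightarrow> \<Sigma>M \<rightarrow> 0\<close> are given by two functions on objects:
  \<open>i M\<close> is the preenvelope and \<open>c M\<close> its cokernel, so \<open>\<Sigma>M\<close> is \<open>Cod C (c M)\<close>.  Dually
  \<open>p M\<close> is the precover and \<open>k M\<close> its kernel, so \<open>\<Omega>M\<close> is \<open>Dom C (k M)\<close>.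
\<close>

definition suspension_data ::
    "('o, 'm) cat \<Rightarrow> 'o set \<Rightarrow> ('o \<Rightarrow> 'm) \<Rightarrow> ('o \<Rightarrow> 'm) \<Rightarrow> bool" where
  "suspension_data C T i c \<longleftrightarrow>
     (\<forall>M \<in> Obj C. preenvelope C T M (i M) \<and> is_cokernel C (i M) (c M))"

definition loop_data ::
    "('o, 'm) cat \<Rightarrow> 'o set \<Rightarrow> ('o \<Rightarrow> 'm) \<Rightarrow> ('o \<Rightarrow> 'm) \<Rightarrow> bool" where
  "loop_data C T p k \<longleftrightarrow>
     (\<forall>M \<in> Obj C. precover C T M (p M) \<and> is_kernel C (p M) (k M))"

text \<open>
  The suspension functor on arrows: \<open>f : L \<rightarrow> M\<close> lifts to \<open>t : T\<^sup>L \<rightarrow> T\<^sup>M\<close>, which induces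
  \<open>s : \<Sigma>L \<rightarrow> \<Sigma>M\<close>; the class of \<open>s\<close> depends only on the class of \<open>f\<close>.
\<close>

definition suspension_arr ::
    "('o, 'm) cat \<Rightarrow> 'o set \<Rightarrow> ('o \<Rightarrow> 'm) \<Rightarrow> ('o \<Rightarrow> 'm) \<Rightarrow> 'm set \<Rightarrow> 'm set" where
  "suspension_arr C T i c a =
     (THE \<sigma>. \<exists>f \<in> a.
        \<exists>t \<in> Hom C (Cod C (i (Dom C f))) (Cod C (i (Cod C f))).
        \<exists>s \<in> Hom C (Cod C (c (Dom C f))) (Cod C (c (Cod C f))).
          t \<cdot>\<^bsub>C\<^esub> i (Dom C f) = i (Cod C f) \<cdot>\<^bsub>C\<^esub> f \<and>
          s \<cdot>\<^bsub>C\<^esub> c (Dom C f) = c (Cod C f) \<cdot>\<^bsub>C\<^esub> t \<and>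
          \<sigma> = stable_class C T s)"

definition standard_right_triangle ::
    "('o, 'm) cat \<Rightarrow> ('o \<Rightarrow> 'm) \<Rightarrow> ('o \<Rightarrow> 'm) \<Rightarrow> 'm \<Rightarrow> 'm \<Rightarrow> 'm \<Rightarrow> bool" where
  "standard_right_triangle C i c f g h \<longleftrightarrow>
     (\<exists>j. is_pushout C (i (Dom C f)) f j g \<and>
        h \<in> Hom C (Cod C g) (Cod C (c (Dom C f))) \<and>
        h \<cdot>\<^bsub>C\<^esub> g = Zero C (Dom C g) (Cod C (c (Dom C f))) \<and>
        h \<cdot>\<^bsub>C\<^esub> j = c (Dom C f))"

definition right_triangle ::
    "('o, 'm) cat \<Rightarrow> 'o set \<Rightarrow> ('o \<Rightarrow> 'm) \<Rightarrow> ('o \<Rightarrow> 'm) \<Rightarrow>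
     'm set \<Rightarrow> 'm set \<Rightarrow> 'm set \<Rightarrow> bool" where
  "right_triangle C T i c \<alpha> \<beta> \<gamma> \<longleftrightarrow>
     (let S = stable_category C T in
      {\<alpha>, \<beta>, \<gamma>} \<subseteq> Arr S \<and> Dom S \<beta> = Cod S \<alpha> \<and> Dom S \<gamma> = Cod S \<beta> \<and>
      Cod S \<gamma> = Cod C (c (Dom S \<alpha>)) \<and>
      (\<exists>f g h. standard_right_triangle C i c f g h \<and>
        (\<exists>x \<in> Hom S (Dom S \<alpha>) (Dom C f).
         \<exists>y \<in> Hom S (Cod S \<alpha>) (Cod C f).
         \<exists>z \<in> Hom S (Cod S \<beta>) (Cod C g).
           iso_arr S x \<and> iso_arr S y \<and> iso_arr S z \<and>
           y \<cdot>\<^bsub>S\<^esub> \<alpha> = stable_class C T f \<cdot>\<^bsub>S\<^esub> x \<and>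
           z \<cdot>\<^bsub>S\<^esub> \<beta> = stable_class C T g \<cdot>\<^bsub>S\<^esub> y \<and>
           suspension_arr C T i c x \<cdot>\<^bsub>S\<^esub> \<gamma> = stable_class C T h \<cdot>\<^bsub>S\<^esub> z)))"

text \<open>
  A left triangle \<open>\<Omega>N \<rightarrow> L \<rightarrow> M \<rightarrow> N\<close>, with arrows \<open>\<gamma>\<close>, \<open>\<beta>\<close>, \<open>\<alpha>\<close> in this order, is a right
  triangle over the opposite category: there precovers become preenvelopes, kernels become
  cokernels and pullbacks become pushouts, while the stable classes remain the same sets.
\<close>

definition left_triangle ::
    "('o, 'm) cat \<Rightarrow> 'o set \<Rightarrow> ('o \<Rightarrow> 'm) \<Rightarrow> ('o \<Rightarrow> 'm) \<Rightarrow>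
     'm set \<Rightarrow> 'm set \<Rightarrow> 'm set \<Rightarrow> bool" where
  "left_triangle C T p k \<gamma> \<beta> \<alpha> \<longleftrightarrow> right_triangle (opposite C) T p k \<alpha> \<beta> \<gamma>"

definition weakly_balanced ::
    "('o, 'm) cat \<Rightarrow> 'o set \<Rightarrow> ('o \<Rightarrow> 'm) \<Rightarrow> ('o \<Rightarrow> 'm) \<Rightarrow> ('o \<Rightarrow> 'm) \<Rightarrow> ('o \<Rightarrow> 'm) \<Rightarrow> bool" where
  "weakly_balanced C T i c p k \<longleftrightarrow>
     (let S = stable_category C T in
      \<forall>\<alpha> \<in> Arr S.
        (\<exists>\<beta> \<gamma>. zero_object S (Dom S \<beta>) \<and> left_triangle C T p k \<gamma> \<beta> \<alpha>) \<and>
        (\<exists>\<beta> \<gamma>. zero_object S (Cod S \<beta>) \<and> right_triangle C T i c \<alpha> \<beta> \<gamma>)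
        \<longrightarrow> iso_arr S \<alpha>)"

end

theory Submission
  imports Defs
begin

text \<open>
  Let \<open>i : M \<rightarrow> E\<close> be a \<open>T\<close>-preenvelope.  Its image is a subobject of an object of \<open>T\<close>, hence projective,
  so \<open>M\<close> is the direct sum of the kernel and the image.  An arrow from the kernel to \<open>T\<close> then
  extends to \<open>M\<close>, factors through \<open>i\<close> and so vanishes.  Hence \<open>left_perp C T\<close> and
  \<open>Sub C T\<close> always form a split torsion pair, and only its heredity is in question: is the left
  perpendicular category closed under subobjects?

  Suppose it is, and let the class of \<open>f : M \<rightarrow> N\<close> be monic and epic.  The arrow
  \<open>(f, i) : M \<rightarrow> N \<oplus> E\<close> is stably isomorphic to \<open>f\<close>.  Its kernel is perpendicular to \<open>T\<close>, and the
  inclusion of this kernel factors through \<open>T\<close> because \<open>f\<close> is stably monic; so the kernel is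
  zero.  The cokernel of \<open>(f, i)\<close> factors through \<open>T\<close> because \<open>f\<close> is stably epic, and lifting this
  factorization along the cokernel, by projectivity, writes the identity of \<open>N \<oplus> E\<close> as
  \<open>(f, i) \<cdot> r\<close> plus an arrow that factors through \<open>T\<close>.  So \<open>f\<close> is a stably split epimorphism which
  is stably monic (\<open>balanced_if_closed\<close>).

  Conversely let \<open>Y \<rightarrow> X\<close> be a monomorphism with \<open>X\<close> in the left perpendicular category.  Choose a
  preenvelope \<open>f : Y \<rightarrow> F\<close> whose cokernel is also perpendicular to \<open>T\<close>, let \<open>N\<close> be the pushout of
  \<open>X\<close> and \<open>F\<close> over \<open>Y\<close>, and let \<open>\<pi> : N \<rightarrow> X/Y\<close> be the induced epimorphism, with kernel \<open>F\<close>
  (\<open>obtain_torsion_epimorphism\<close>).  As the kernel is in \<open>T\<close> and source and target are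
  perpendicular to \<open>T\<close>, the class of \<open>\<pi>\<close> is monic and epic, and it also fits into a left and
  a right triangle with a zero object.  If the stable category is balanced, or only weakly balanced,
  the class is therefore an isomorphism.  But nonzero arrows out of perpendicular objects do not
  factor through \<open>T\<close>, so \<open>\<pi>\<close> has a left inverse, its kernel vanishes, \<open>f\<close> is zero, and \<open>Y\<close> is
  perpendicular to \<open>T\<close>.  That balanced implies weakly balanced holds because the triangles in
  question force the arrow to be monic and epic (\<open>right_triangle_epic\<close>).

  For the injective embeddings, extend an arrow \<open>Y \<rightarrow> T\<close> to \<open>X\<close> after composing with an embedding
  into an injective object of \<open>T\<close> to see that it vanishes.  In the other direction, embed an object
  of \<open>T\<close> into an injective object and project this onto the torsion-free part; heredity keeps the
  composite monic, and the torsion-free part, being injective inside an object of \<open>T\<close>, is a summand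
  of it.

  Statements about left triangles, monomorphisms and kernels are turned into statements about right
  triangles, epimorphisms and cokernels by passing to the opposite category.
\<close>

section \<open>Arrows in preadditive categories\<close>

context category
begin

lemma HomD: "f \<in> Hom C X Y \<Longrightarrow> f \<in> Arr C" "f \<in> Hom C X Y \<Longrightarrow> Dom C f = X"
    "f \<in> Hom C X Y \<Longrightarrow> Cod C f = Y"
  by (auto simp: Hom_def)

lemma Hom_objects: "f \<in> Hom C X Y \<Longrightarrow> X \<in> Obj C" "f \<in> Hom C X Y \<Longrightarrow> Y \<in> Obj C"
  using Dom_in_Obj Cod_in_Obj by (auto simp: Hom_def)

lemmas Hom_simps = HomD Hom_objects

text \<open>
  Composability is phrased through \<open>Dom\<close> and \<open>Cod\<close>, rather than \<open>Hom\<close>, in the rewrite rules: the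
  side conditions then contain no variables beyond those of the term to be rewritten.
\<close>

lemma Comp_typing [simp]:
  assumes "f \<in> Arr C" "g \<in> Arr C" "Cod C f = Dom C g"
  shows "g \<cdot> f \<in> Arr C" "Dom C (g \<cdot> f) = Dom C f" "Cod C (g \<cdot> f) = Cod C g"
  using Comp_in_Hom[of f "Dom C f" "Dom C g" g "Cod C g"] assms by (auto simp: Hom_def)

lemma Ident_typing [simp]:
  assumes "X \<in> Obj C"
  shows "Ident C X \<in> Arr C" "Dom C (Ident C X) = X" "Cod C (Ident C X) = X"
  using Ident_in_Hom[OF assms] by (auto simp: Hom_def)

lemma Comp_assoc_Arr [simp]:
  "f \<in> Arr C \<Longrightarrow> g \<in> Arr C \<Longrightarrow> h \<in> Arr C \<Longrightarrow> Cod C f = Dom C g \<Longrightarrow> Cod C g = Dom C h \<Longrightarrow>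
    (h \<cdot> g) \<cdot> f = h \<cdot> g \<cdot> f"
  by (rule Comp_assoc[of _ "Dom C f" "Dom C g" _ "Dom C h" _ "Cod C h"]) (auto simp: Hom_def)

lemma Comp_Ident_Arr [simp]:
  "f \<in> Arr C \<Longrightarrow> X = Dom C f \<Longrightarrow> f \<cdot> Ident C X = f"
  "f \<in> Arr C \<Longrightarrow> Y = Cod C f \<Longrightarrow> Ident C Y \<cdot> f = f"
  using Comp_Ident Ident_Comp by (auto simp: Hom_def)

lemma Arr_objects [simp]:
  "f \<in> Arr C \<Longrightarrow> Dom C f \<in> Obj C" "f \<in> Arr C \<Longrightarrow> Cod C f \<in> Obj C"
  by (fact Dom_in_Obj, fact Cod_in_Obj)

text \<open>
  Composites are normalized to the right, which hides a known composite \<open>g \<cdot> f\<close> that is followed by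
  a further arrow; this form of an equation still applies there.
\<close>

lemma Comp_eq_extend:
  assumes "g \<cdot> f = k" "f \<in> Arr C" "g \<in> Arr C" "x \<in> Arr C" "Cod C f = Dom C g" "Cod C x = Dom C f"
  shows "g \<cdot> f \<cdot> x = k \<cdot> x"
  using assms Comp_assoc_Arr[of x f g] by simp

lemma monicD:
  assumes "monic C m" "m \<cdot> u = m \<cdot> v" "u \<in> Hom C W (Dom C m)" "v \<in> Hom C W (Dom C m)"
  shows "u = v"
  using assms unfolding monic_def by blast

lemma epicD:
  assumes "epic C e" "u \<cdot> e = v \<cdot> e" "u \<in> Hom C (Cod C e) W" "v \<in> Hom C (Cod C e) W"
  shows "u = v"
  using assms unfolding epic_def by blast

lemma monic_Comp:
  assumes "monic C m" "monic C k" "k \<in> Hom C X Y" "m \<in> Hom C Y Z"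
  shows "monic C (m \<cdot> k)"
  unfolding monic_def
proof (intro conjI allI ballI impI)
  note [simp] = HomD[OF assms(3)] HomD[OF assms(4)]
  show "m \<cdot> k \<in> Arr C" by simp
  fix V x y assume "x \<in> Hom C V (Dom C (m \<cdot> k))" "y \<in> Hom C V (Dom C (m \<cdot> k))"
    and xy: "(m \<cdot> k) \<cdot> x = (m \<cdot> k) \<cdot> y"
  then have H: "x \<in> Hom C V X" "y \<in> Hom C V X" by simp_all
  note [simp] = HomD[OF H(1)] HomD[OF H(2)]
  have "k \<cdot> x = k \<cdot> y"
    by (rule monicD[OF assms(1), of _ _ V]) (use xy in \<open>simp_all add: Hom_def\<close>)
  then show "x = y"
    by (rule monicD[OF assms(2), of _ _ V]) (simp_all add: Hom_def)
qed

lemma iso_arrE: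
  assumes "iso_arr C f" "f \<in> Hom C X Y"
  obtains g where "g \<in> Hom C Y X" "g \<cdot> f = Ident C X" "f \<cdot> g = Ident C Y"
  using assms unfolding iso_arr_def Hom_def by auto

lemma iso_Ident: "X \<in> Obj C \<Longrightarrow> iso_arr C (Ident C X)"
  unfolding iso_arr_def using Ident_in_Hom[of X] by force

end

context preadditive_category
begin

abbreviation add (infixl "\<oplus>" 65) where "f \<oplus> g \<equiv> Plus C f g"

definition neg where "neg f = inv\<^bsub>hom_group C (Dom C f) (Cod C f)\<^esub> f"

lemma Zero_typing [simp]:
  assumes "X \<in> Obj C" "Y \<in> Obj C"
  shows "Zero C X Y \<in> Arr C" "Dom C (Zero C X Y) = X" "Cod C (Zero C X Y) = Y"
proof -
  interpret comm_group "hom_group C X Y" using hom_comm_group assms by blast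
  show "Zero C X Y \<in> Arr C" "Dom C (Zero C X Y) = X" "Cod C (Zero C X Y) = Y"
    using one_closed by (auto simp: hom_group_def Hom_def)
qed

lemma Plus_laws:
  assumes "f \<in> Arr C" "g \<in> Arr C" "Dom C f = Dom C g" "Cod C f = Cod C g"
  shows Plus_typing [simp]: "f \<oplus> g \<in> Arr C" "Dom C (f \<oplus> g) = Dom C g" "Cod C (f \<oplus> g) = Cod C g"
    and Plus_commute: "f \<oplus> g = g \<oplus> f"
    and Plus_assoc: "h \<in> Arr C \<Longrightarrow> Dom C h = Dom C g \<Longrightarrow> Cod C h = Cod C g \<Longrightarrow>
      (f \<oplus> g) \<oplus> h = f \<oplus> (g \<oplus> h)"
proof -
  interpret comm_group "hom_group C (Dom C f) (Cod C f)" using hom_comm_group assms by simp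
  show "f \<oplus> g \<in> Arr C" "Dom C (f \<oplus> g) = Dom C g" "Cod C (f \<oplus> g) = Cod C g"
    using m_closed[of f g] assms by (auto simp: hom_group_def Hom_def)
  show "f \<oplus> g = g \<oplus> f"
    using m_comm[of f g] assms by (auto simp: hom_group_def Hom_def)
  show "(f \<oplus> g) \<oplus> h = f \<oplus> (g \<oplus> h)" if "h \<in> Arr C" "Dom C h = Dom C g" "Cod C h = Cod C g"
    using m_assoc[of f g h] assms that by (auto simp: hom_group_def Hom_def)
qed

lemma neg_laws:
  assumes "f \<in> Arr C"
  shows neg_typing [simp]: "neg f \<in> Arr C" "Dom C (neg f) = Dom C f" "Cod C (neg f) = Cod C f"
    and Plus_neg: "X = Dom C f \<Longrightarrow> Y = Cod C f \<Longrightarrow> f \<oplus> neg f = Zero C X Y"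
    and Plus_Zero [simp]: "X = Dom C f \<Longrightarrow> Y = Cod C f \<Longrightarrow> f \<oplus> Zero C X Y = f"
      "X = Dom C f \<Longrightarrow> Y = Cod C f \<Longrightarrow> Zero C X Y \<oplus> f = f"
proof -
  interpret comm_group "hom_group C (Dom C f) (Cod C f)" using hom_comm_group assms by simp
  show "neg f \<in> Arr C" "Dom C (neg f) = Dom C f" "Cod C (neg f) = Cod C f"
    using inv_closed[of f] assms by (auto simp: neg_def hom_group_def Hom_def)
  show "f \<oplus> neg f = Zero C X Y" if "X = Dom C f" "Y = Cod C f"
    using r_inv[of f] assms that by (auto simp: neg_def hom_group_def Hom_def)
  show "f \<oplus> Zero C X Y = f" "Zero C X Y \<oplus> f = f" if "X = Dom C f" "Y = Cod C f"
    using r_one[of f] l_one[of f] assms that by (auto simp: hom_group_def Hom_def)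
qed

lemma Plus_cancel:
  assumes "f \<oplus> g = f \<oplus> h" "f \<in> Arr C" "g \<in> Arr C" "h \<in> Arr C"
    "Dom C f = Dom C g" "Cod C f = Cod C g" "Dom C f = Dom C h" "Cod C f = Cod C h"
  shows "g = h"
proof -
  interpret comm_group "hom_group C (Dom C f) (Cod C f)" using hom_comm_group assms by simp
  show ?thesis using Units_l_cancel[of f g h] assms Units_eq by (auto simp: hom_group_def Hom_def)
qed

lemma Comp_distrib [simp]:
  "f \<in> Arr C \<Longrightarrow> g \<in> Arr C \<Longrightarrow> h \<in> Arr C \<Longrightarrow> Cod C f = Dom C g \<Longrightarrow> Dom C h = Dom C g \<Longrightarrow>
    Cod C g = Cod C h \<Longrightarrow> (g \<oplus> h) \<cdot> f = g \<cdot> f \<oplus> h \<cdot> f"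
  "f \<in> Arr C \<Longrightarrow> g \<in> Arr C \<Longrightarrow> h \<in> Arr C \<Longrightarrow> Cod C g = Dom C f \<Longrightarrow> Dom C h = Dom C g \<Longrightarrow>
    Cod C g = Cod C h \<Longrightarrow> f \<cdot> (g \<oplus> h) = f \<cdot> g \<oplus> f \<cdot> h"
  using Comp_Plus[of f "Dom C f" "Dom C g" g "Cod C g" h]
    Plus_Comp[of g "Dom C g" "Dom C f" h f "Cod C f"] by (auto simp: Hom_def)

lemma Comp_Zero [simp]:
  assumes "f \<in> Arr C" "Y \<in> Obj C"
  shows "X = Cod C f \<Longrightarrow> Zero C X Y \<cdot> f = Zero C (Dom C f) Y"
    "X = Dom C f \<Longrightarrow> f \<cdot> Zero C Y X = Zero C Y (Cod C f)"
proof -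
  let ?z = "Zero C (Cod C f) Y"
  have "?z \<cdot> f \<oplus> ?z \<cdot> f = ?z \<cdot> f \<oplus> Zero C (Dom C f) Y"
    using assms by (simp flip: Comp_distrib)
  then have "?z \<cdot> f = Zero C (Dom C f) Y"
    by (rule Plus_cancel) (use assms in simp_all)
  then show "X = Cod C f \<Longrightarrow> Zero C X Y \<cdot> f = Zero C (Dom C f) Y" by simp
  let ?z = "Zero C Y (Dom C f)"
  have "f \<cdot> ?z \<oplus> f \<cdot> ?z = f \<cdot> ?z \<oplus> Zero C Y (Cod C f)"
    using assms Comp_distrib(2)[of f ?z ?z] by simp
  then have "f \<cdot> ?z = Zero C Y (Cod C f)"
    by (rule Plus_cancel) (use assms in simp_all)
  then show "X = Dom C f \<Longrightarrow> f \<cdot> Zero C Y X = Zero C Y (Cod C f)" by simp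
qed

lemma neg_unique:
  assumes "f \<oplus> g = Zero C (Dom C f) (Cod C f)" "f \<in> Arr C" "g \<in> Arr C"
    "Dom C f = Dom C g" "Cod C f = Cod C g"
  shows "neg f = g"
  using assms Plus_cancel[of f "neg f" g] by (simp add: Plus_neg)

lemma Comp_neg [simp]:
  assumes "f \<in> Arr C" "g \<in> Arr C" "Cod C f = Dom C g"
  shows "neg g \<cdot> f = neg (g \<cdot> f)" "g \<cdot> neg f = neg (g \<cdot> f)"
proof -
  have "g \<cdot> f \<oplus> neg g \<cdot> f = Zero C (Dom C f) (Cod C g)"
    using assms Comp_distrib(1)[of f g "neg g"] by (simp add: Plus_neg del: Comp_distrib)
  then show "neg g \<cdot> f = neg (g \<cdot> f)"
    using assms by (intro neg_unique[symmetric]) simp_all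
  have "g \<cdot> f \<oplus> g \<cdot> neg f = Zero C (Dom C f) (Cod C g)"
    using assms Comp_distrib(2)[of g f "neg f"] by (simp add: Plus_neg del: Comp_distrib)
  then show "g \<cdot> neg f = neg (g \<cdot> f)"
    using assms by (intro neg_unique[symmetric]) simp_all
qed

lemma neg_Zero [simp]: "X \<in> Obj C \<Longrightarrow> Y \<in> Obj C \<Longrightarrow> neg (Zero C X Y) = Zero C X Y"
  by (rule neg_unique) simp_all

lemma eq_iff_diff:
  assumes "f \<in> Arr C" "g \<in> Arr C" "Dom C f = Dom C g" "Cod C f = Cod C g"
  shows "f = g \<longleftrightarrow> f \<oplus> neg g = Zero C (Dom C g) (Cod C g)"
proof
  assume "f \<oplus> neg g = Zero C (Dom C g) (Cod C g)"
  then have "neg g \<oplus> f = neg g \<oplus> g"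
    using assms by (simp add: Plus_commute[of "neg g"] Plus_neg)
  then show "f = g" by (rule Plus_cancel) (use assms in simp_all)
qed (use assms in \<open>simp add: Plus_neg\<close>)

lemma diff_eq_iff:
  assumes "f \<in> Arr C" "g \<in> Arr C" "d \<in> Arr C" "Dom C f = Dom C g" "Cod C f = Cod C g"
     "Dom C d = Dom C g" "Cod C d = Cod C g"
  shows "f \<oplus> neg g = d \<longleftrightarrow> f = g \<oplus> d"
proof
  assume "f \<oplus> neg g = d"
  then show "f = g \<oplus> d"
    using assms by (auto simp: Plus_commute[of g] Plus_assoc Plus_commute[of "neg g"] Plus_neg)
next
  assume "f = g \<oplus> d"
  then show "f \<oplus> neg g = d"
    using assms by (simp add: Plus_commute[of g] Plus_assoc Plus_neg)
qed

lemma monic_iff_zero: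
  assumes "m \<in> Hom C X Y"
  shows "monic C m \<longleftrightarrow> (\<forall>W. \<forall>u \<in> Hom C W X. m \<cdot> u = Zero C W Y \<longrightarrow> u = Zero C W X)"
proof
  assume m: "monic C m"
  show "\<forall>W. \<forall>u \<in> Hom C W X. m \<cdot> u = Zero C W Y \<longrightarrow> u = Zero C W X"
  proof (intro allI ballI impI)
    fix W u assume u: "u \<in> Hom C W X" "m \<cdot> u = Zero C W Y"
    then have "m \<cdot> u = m \<cdot> Zero C W X" using assms by (auto simp: Hom_def)
    then show "u = Zero C W X"
      by (rule monicD[OF m]) (use u assms in \<open>auto simp: Hom_def\<close>)
  qed
next
  assume r: "\<forall>W. \<forall>u \<in> Hom C W X. m \<cdot> u = Zero C W Y \<longrightarrow> u = Zero C W X"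
  show "monic C m"
    unfolding monic_def
  proof (intro conjI allI ballI impI)
    show "m \<in> Arr C" using assms by (simp add: Hom_def)
    fix W u v assume uv: "u \<in> Hom C W (Dom C m)" "v \<in> Hom C W (Dom C m)" "m \<cdot> u = m \<cdot> v"
    then have "u \<oplus> neg v \<in> Hom C W X" "m \<cdot> (u \<oplus> neg v) = Zero C W Y"
      using assms by (auto simp: Hom_def Plus_neg)
    then have "u \<oplus> neg v = Zero C W X" using r by blast
    then show "u = v" using uv assms by (subst eq_iff_diff) (auto simp: Hom_def)
  qed
qed

end

section \<open>The opposite category\<close>

lemma opposite_sel [simp]:
  "Obj (opposite D) = Obj D" "Arr (opposite D) = Arr D" "Dom (opposite D) = Cod D"
  "Cod (opposite D) = Dom D" "Ident (opposite D) = Ident D"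
  "Comp (opposite D) g f = Comp D f g" "Plus (opposite D) = Plus D"
  "Zero (opposite D) X Y = Zero D Y X"
  by (simp_all add: opposite_def)

lemma Hom_opposite [simp]: "Hom (opposite D) X Y = Hom D Y X"
  by (auto simp: Hom_def)

lemma monic_opposite [simp]: "monic (opposite D) f \<longleftrightarrow> epic D f"
  by (simp add: monic_def epic_def)

lemma epic_opposite [simp]: "epic (opposite D) f \<longleftrightarrow> monic D f"
  by (simp add: monic_def epic_def)

lemma iso_arr_opposite [simp]: "iso_arr (opposite D) f \<longleftrightarrow> iso_arr D f"
  by (auto simp: iso_arr_def)

lemma zero_object_opposite [simp]: "zero_object (opposite D) Z \<longleftrightarrow> zero_object D Z"
  by (auto simp: zero_object_def)

lemma is_kernel_opposite [simp]: "is_kernel (opposite D) f k \<longleftrightarrow> is_cokernel D f k"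
  by (auto simp: is_kernel_def is_cokernel_def)

lemma is_cokernel_opposite [simp]: "is_cokernel (opposite D) f k \<longleftrightarrow> is_kernel D f k"
  by (simp add: is_kernel_def is_cokernel_def)

lemma biproduct_opposite [simp]:
  "biproduct (opposite D) X Y Z i\<^sub>1 i\<^sub>2 p\<^sub>1 p\<^sub>2 \<longleftrightarrow> biproduct D X Y Z p\<^sub>1 p\<^sub>2 i\<^sub>1 i\<^sub>2"
  by (auto simp: biproduct_def)

lemma is_direct_sum_opposite [simp]: "is_direct_sum (opposite D) X Y Z \<longleftrightarrow> is_direct_sum D X Y Z"
  by (auto simp: is_direct_sum_def)

lemma hom_group_opposite [simp]: "hom_group (opposite D) X Y = hom_group D Y X"
  by (simp add: hom_group_def)

lemma (in category) category_opposite: "category (opposite C)"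
  by unfold_locales (use Ident_in_Hom in \<open>simp_all add: Hom_def\<close>)

lemma (in preadditive_category) preadditive_opposite: "preadditive_category (opposite C)"
  by (intro preadditive_category.intro preadditive_category_axioms.intro category_opposite)
    (simp_all add: hom_comm_group Hom_def)

lemma (in abelian_category) abelian_opposite: "abelian_category (opposite C)"
proof -
  interpret op: preadditive_category "opposite C" by (fact preadditive_opposite)
  show ?thesis
    by unfold_locales (simp_all add: zero_object_exists direct_sum_exists kernel_exists
        cokernel_exists monic_is_kernel epic_is_cokernel)
qed

section \<open>Kernels, images and biproducts\<close>

context preadditive_category
begin

lemma kernelD:
  assumes "is_kernel C f k" "f \<in> Hom C X Y" "k \<in> Hom C K X"
  shows "f \<cdot> k = Zero C K Y"
  using assms by (auto simp: is_kernel_def Hom_def)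

lemma kernel_lift:
  assumes "is_kernel C f k" "f \<in> Hom C X Y" "k \<in> Hom C K X" "x \<in> Hom C W X" "f \<cdot> x = Zero C W Y"
  obtains y where "y \<in> Hom C W K" "k \<cdot> y = x"
proof -
  have "Dom C f = X" "Cod C f = Y" "Dom C k = K" using assms(2,3) by (simp_all add: Hom_def)
  then have "\<exists>!y. y \<in> Hom C W K \<and> k \<cdot> y = x"
    using assms(1,4,5) unfolding is_kernel_def by blast
  then show thesis using that by blast
qed

lemma kernel_monic:
  assumes "is_kernel C f k"
  shows "monic C k"
  unfolding monic_def
proof (intro conjI allI ballI impI)
  have k: "f \<in> Arr C" "k \<in> Arr C" "Cod C k = Dom C f" "f \<cdot> k = Zero C (Dom C k) (Cod C f)"
    using assms by (auto simp: is_kernel_def)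
  then show "k \<in> Arr C" by blast
  fix W u v assume uv: "u \<in> Hom C W (Dom C k)" "v \<in> Hom C W (Dom C k)" "k \<cdot> u = k \<cdot> v"
  then have "k \<cdot> v \<in> Hom C W (Dom C f)" "f \<cdot> k \<cdot> v = Zero C W (Cod C f)"
    using k by (auto simp: Hom_def Comp_eq_extend[OF k(4)])
  then have "\<exists>!y. y \<in> Hom C W (Dom C k) \<and> k \<cdot> y = k \<cdot> v"
    using assms unfolding is_kernel_def by blast
  then show "u = v" using uv by blast
qed

lemma cokernelD:
  assumes "is_cokernel C f c" "f \<in> Hom C X Y" "c \<in> Hom C Y Q"
  shows "c \<cdot> f = Zero C X Q"
  using assms by (auto simp: is_cokernel_def Hom_def)

lemma cokernel_factor:
  assumes "is_cokernel C f c" "f \<in> Hom C X Y" "c \<in> Hom C Y Q" "x \<in> Hom C Y W" "x \<cdot> f = Zero C X W"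
  obtains y where "y \<in> Hom C Q W" "y \<cdot> c = x"
  using preadditive_category.kernel_lift[OF preadditive_opposite, of f c Y X Q x W] assms by auto

lemma cokernel_epic: "is_cokernel C f c \<Longrightarrow> epic C c"
  using preadditive_category.kernel_monic[OF preadditive_opposite, of f c] by simp

lemma epic_iff_zero:
  assumes "e \<in> Hom C X Y"
  shows "epic C e \<longleftrightarrow> (\<forall>W. \<forall>u \<in> Hom C Y W. u \<cdot> e = Zero C X W \<longrightarrow> u = Zero C Y W)"
  using preadditive_category.monic_iff_zero[OF preadditive_opposite, of e Y X] assms by simp

lemma iso_arr_monic:
  assumes "iso_arr C f"
  shows "monic C f"
proof -
  have fH: "f \<in> Hom C (Dom C f) (Cod C f)" using assms by (simp add: iso_arr_def Hom_def)
  obtain g where g: "g \<in> Hom C (Cod C f) (Dom C f)" "g \<cdot> f = Ident C (Dom C f)"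
    using iso_arrE[OF assms fH] by metis
  note [simp] = HomD[OF g(1)] HomD(1)[OF fH]
  show ?thesis
    unfolding monic_iff_zero[OF fH]
  proof (intro allI ballI impI)
    fix W u assume u: "u \<in> Hom C W (Dom C f)" "f \<cdot> u = Zero C W (Cod C f)"
    note [simp] = Hom_simps[OF u(1)]
    have "u = g \<cdot> f \<cdot> u" by (simp add: Comp_eq_extend[OF g(2)])
    then show "u = Zero C W (Dom C f)" by (simp only: u(2)) simp
  qed
qed

lemma iso_arr_epic: "iso_arr C f \<Longrightarrow> epic C f"
  using preadditive_category.iso_arr_monic[OF preadditive_opposite, of f] by simp

lemma is_kernelI:
  assumes "monic C k" "k \<in> Hom C K X" "f \<in> Hom C X Y" "f \<cdot> k = Zero C K Y"
    and "\<And>W x. x \<in> Hom C W X \<Longrightarrow> f \<cdot> x = Zero C W Y \<Longrightarrow> \<exists>y \<in> Hom C W K. k \<cdot> y = x"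
  shows "is_kernel C f k"
proof -
  have "\<exists>!y. y \<in> Hom C W (Dom C k) \<and> k \<cdot> y = x"
    if x: "x \<in> Hom C W (Dom C f)" "f \<cdot> x = Zero C W (Cod C f)" for W x
  proof -
    have D: "Dom C f = X" "Cod C f = Y" "Dom C k = K" using assms(2,3) by (auto simp: Hom_def)
    then obtain y where y: "y \<in> Hom C W K" "k \<cdot> y = x" using assms(5)[of x W] x by metis
    have "y' = y" if "y' \<in> Hom C W K" "k \<cdot> y' = x" for y'
      by (rule monicD[OF assms(1), of _ _ W]) (use that y D in simp_all)
    then show ?thesis using y by (auto simp: D)
  qed
  then show ?thesis using assms(2-4) unfolding is_kernel_def Hom_def by auto
qed

lemma is_cokernelI:
  assumes "epic C c" "c \<in> Hom C Y Q" "f \<in> Hom C X Y" "c \<cdot> f = Zero C X Q"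
    and "\<And>W x. x \<in> Hom C Y W \<Longrightarrow> x \<cdot> f = Zero C X W \<Longrightarrow> \<exists>y \<in> Hom C Q W. y \<cdot> c = x"
  shows "is_cokernel C f c"
  using preadditive_category.is_kernelI[OF preadditive_opposite, of c Q Y f X] assms by simp

lemma biproductD:
  assumes "biproduct C X Y Z i\<^sub>1 i\<^sub>2 p\<^sub>1 p\<^sub>2"
  shows "i\<^sub>1 \<in> Hom C X Z" "i\<^sub>2 \<in> Hom C Y Z" "p\<^sub>1 \<in> Hom C Z X" "p\<^sub>2 \<in> Hom C Z Y"
     "p\<^sub>1 \<cdot> i\<^sub>1 = Ident C X" "p\<^sub>2 \<cdot> i\<^sub>2 = Ident C Y" "p\<^sub>1 \<cdot> i\<^sub>2 = Zero C Y X"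
     "p\<^sub>2 \<cdot> i\<^sub>1 = Zero C X Y" "i\<^sub>1 \<cdot> p\<^sub>1 \<oplus> i\<^sub>2 \<cdot> p\<^sub>2 = Ident C Z"
  using assms by (auto simp: biproduct_def)

lemma biproduct_commute:
  assumes "biproduct C X Y Z i\<^sub>1 i\<^sub>2 p\<^sub>1 p\<^sub>2"
  shows "biproduct C Y X Z i\<^sub>2 i\<^sub>1 p\<^sub>2 p\<^sub>1"
proof -
  note D = biproductD[OF assms]
  have "i\<^sub>2 \<cdot> p\<^sub>2 \<oplus> i\<^sub>1 \<cdot> p\<^sub>1 = i\<^sub>1 \<cdot> p\<^sub>1 \<oplus> i\<^sub>2 \<cdot> p\<^sub>2"
    by (rule Plus_commute) (use HomD[OF D(1)] HomD[OF D(2)] HomD[OF D(3)] HomD[OF D(4)] in simp_all)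
  then show ?thesis unfolding biproduct_def using D by simp
qed

lemma biproduct_direct_sum:
  assumes "biproduct C X Y Z i\<^sub>1 i\<^sub>2 p\<^sub>1 p\<^sub>2"
  shows "is_direct_sum C X Y Z"
  unfolding is_direct_sum_def using assms biproductD(1,2)[OF assms] Hom_objects by blast

text \<open>
  The retraction is the lift of \<open>1 - s \<cdot> e\<close> through the kernel.
\<close>

lemma split_kernel_biproduct:
  assumes e: "e \<in> Hom C M I" and s: "s \<in> Hom C I M" "e \<cdot> s = Ident C I"
    and k: "is_kernel C e k" "k \<in> Hom C K M"
  obtains r where "biproduct C K I M k s r e"
proof -
  have ek: "e \<cdot> k = Zero C K I" by (rule kernelD) fact+
  have obj: "I \<in> Obj C" "M \<in> Obj C" "K \<in> Obj C" using Hom_objects[OF e] Hom_objects[OF k(2)] by auto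
  note [simp] = HomD[OF e] HomD[OF s(1)] HomD[OF k(2)] s(2) ek obj
    Comp_eq_extend[OF s(2)] Comp_eq_extend[OF ek]
  let ?x = "Ident C M \<oplus> neg (s \<cdot> e)"
  have "?x \<in> Hom C M M" "e \<cdot> ?x = Zero C M I"
    by (simp_all add: Hom_def Plus_neg)
  then obtain r where r: "r \<in> Hom C M K" "k \<cdot> r = ?x"
    using kernel_lift[OF k(1) e k(2)] by metis
  note [simp] = HomD[OF r(1)]
  note mono = kernel_monic[OF k(1)]
  have "k \<cdot> r \<cdot> k = (k \<cdot> r) \<cdot> k" by simp
  also have "\<dots> = k \<cdot> Ident C K" by (subst r(2)) simp
  finally have rk: "r \<cdot> k = Ident C K"
    by (rule monicD[OF mono]) (simp_all add: Hom_def)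
  have "k \<cdot> r \<cdot> s = (k \<cdot> r) \<cdot> s" by simp
  also have "\<dots> = k \<cdot> Zero C I K" by (subst r(2)) (simp add: Plus_neg)
  finally have rs: "r \<cdot> s = Zero C I K"
    by (rule monicD[OF mono]) (simp_all add: Hom_def)
  have "k \<cdot> r = Ident C M \<oplus> neg (s \<cdot> e)" by (fact r(2))
  then have "s \<cdot> e \<oplus> k \<cdot> r = Ident C M"
    using diff_eq_iff[of "Ident C M" "s \<cdot> e" "k \<cdot> r"] by simp
  then have "k \<cdot> r \<oplus> s \<cdot> e = Ident C M"
    using Plus_commute[of "k \<cdot> r" "s \<cdot> e"] by simp
  then have "biproduct C K I M k s r e"
    unfolding biproduct_def using rk rs ek k(2) e s r(1) by blast
  then show thesis by (rule that)
qed

lemma monic_into_biproduct: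
  assumes bp: "biproduct C X Y Z i\<^sub>1 i\<^sub>2 p\<^sub>1 p\<^sub>2" and a: "a \<in> Hom C W X" and b: "b \<in> Hom C W Y"
    and mono: "\<And>V u. u \<in> Hom C V W \<Longrightarrow> a \<cdot> u = Zero C V X \<Longrightarrow> b \<cdot> u = Zero C V Y \<Longrightarrow> u = Zero C V W"
  shows "monic C (i\<^sub>1 \<cdot> a \<oplus> i\<^sub>2 \<cdot> b)"
proof -
  note D = biproductD[OF bp]
  note [simp] = Hom_simps[OF a] Hom_simps[OF b]
    HomD[OF D(1)] HomD[OF D(2)] HomD[OF D(3)] HomD[OF D(4)] D(5-8)
    Comp_eq_extend[OF D(5)] Comp_eq_extend[OF D(6)] Comp_eq_extend[OF D(7)] Comp_eq_extend[OF D(8)]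
  have Z [simp]: "Z \<in> Obj C" using Hom_objects[OF D(1)] by blast
  have H: "i\<^sub>1 \<cdot> a \<oplus> i\<^sub>2 \<cdot> b \<in> Hom C W Z" by (simp add: Hom_def)
  show ?thesis
    unfolding monic_iff_zero[OF H]
  proof (intro allI ballI impI)
    fix V u assume u: "u \<in> Hom C V W" "(i\<^sub>1 \<cdot> a \<oplus> i\<^sub>2 \<cdot> b) \<cdot> u = Zero C V Z"
    note [simp] = Hom_simps[OF u(1)]
    have "p\<^sub>1 \<cdot> (i\<^sub>1 \<cdot> a \<oplus> i\<^sub>2 \<cdot> b) \<cdot> u = a \<cdot> u" "p\<^sub>2 \<cdot> (i\<^sub>1 \<cdot> a \<oplus> i\<^sub>2 \<cdot> b) \<cdot> u = b \<cdot> u"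
      by simp_all
    then have "a \<cdot> u = Zero C V X" "b \<cdot> u = Zero C V Y" unfolding u(2) by simp_all
    then show "u = Zero C V W" using mono u(1) by blast
  qed
qed

lemma projective_lift:
  assumes "projective C P" "epic C e" "e \<in> Hom C M N" "f \<in> Hom C P N"
  obtains g where "g \<in> Hom C P M" "e \<cdot> g = f"
proof -
  have "Dom C e = M" "Cod C e = N" using assms(3) by (simp_all add: Hom_def)
  then show thesis using assms(1,2,4) that unfolding projective_def by blast
qed

lemma projective_section:
  assumes "projective C I" "epic C e" "e \<in> Hom C M I"
  obtains s where "s \<in> Hom C I M" "e \<cdot> s = Ident C I"
  using projective_lift[OF assms Ident_in_Hom] Hom_objects[OF assms(3)] by blast

end

context abelian_category
begin

lemma obtain_kernel:
  assumes "f \<in> Hom C X Y"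
  obtains K k where "k \<in> Hom C K X" "is_kernel C f k" "f \<cdot> k = Zero C K Y" "monic C k"
proof -
  obtain k where k: "is_kernel C f k" using kernel_exists assms by (auto simp: Hom_def)
  then have kH: "k \<in> Hom C (Dom C k) X" using assms by (auto simp: is_kernel_def Hom_def)
  show thesis by (rule that[OF kH k kernelD[OF k assms kH] kernel_monic[OF k]])
qed

lemma obtain_cokernel:
  assumes "f \<in> Hom C X Y"
  obtains Q c where "c \<in> Hom C Y Q" "is_cokernel C f c" "c \<cdot> f = Zero C X Q" "epic C c"
  using abelian_category.obtain_kernel[OF abelian_opposite, of f Y X thesis] assms that by simp

text \<open>
  A monomorphism is the kernel of some arrow, and that arrow factors through the cokernel.
\<close>

lemma monic_kernel_of_cokernel:
  assumes m: "monic C m" and c: "is_cokernel C m c"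
  shows "is_kernel C c m"
proof -
  obtain f where f: "is_kernel C f m" using monic_is_kernel[OF m] by blast
  define X Y Z Q where "X = Dom C m" and "Y = Cod C m" and "Z = Cod C f" and "Q = Cod C c"
  have mH: "m \<in> Hom C X Y" using m by (auto simp: monic_def Hom_def X_def Y_def)
  have fH: "f \<in> Hom C Y Z" using f by (auto simp: is_kernel_def Hom_def Y_def Z_def)
  have cH: "c \<in> Hom C Y Q" using c by (auto simp: is_cokernel_def Hom_def Y_def Q_def)
  have cm: "c \<cdot> m = Zero C X Q" by (rule cokernelD) fact+
  have fm: "f \<cdot> m = Zero C X Z" by (rule kernelD) fact+
  obtain g where g: "g \<in> Hom C Q Z" "g \<cdot> c = f"
    using cokernel_factor[OF c mH cH fH fm] .
  note [simp] = HomD[OF cH] HomD[OF g(1)] Hom_objects[OF g(1)]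
  show ?thesis
  proof (rule is_kernelI[OF m mH cH cm])
    fix W x assume x: "x \<in> Hom C W Y" "c \<cdot> x = Zero C W Q"
    note [simp] = HomD[OF x(1)] Hom_objects[OF x(1)]
    have "f \<cdot> x = g \<cdot> c \<cdot> x" by (subst g(2)[symmetric]) simp
    also have "\<dots> = Zero C W Z" by (simp add: x(2))
    finally show "\<exists>y \<in> Hom C W X. m \<cdot> y = x"
      using kernel_lift[OF f fH mH x(1)] by metis
  qed
qed

lemma epic_cokernel_of_kernel:
  assumes "epic C e" and "is_kernel C e k"
  shows "is_cokernel C k e"
  using abelian_category.monic_kernel_of_cokernel[OF abelian_opposite, of e k] assms by simp

text \<open>
  The image is the kernel of the cokernel.
\<close>

lemma image_factorization:
  assumes f: "f \<in> Hom C X Y"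
  obtains I e m where "e \<in> Hom C X I" "epic C e" "m \<in> Hom C I Y" "monic C m" "m \<cdot> e = f"
proof -
  obtain Q c where c: "c \<in> Hom C Y Q" "is_cokernel C f c" "c \<cdot> f = Zero C X Q" "epic C c"
    using obtain_cokernel[OF f] .
  obtain I m where m: "m \<in> Hom C I Y" "is_kernel C c m" "c \<cdot> m = Zero C I Q" "monic C m"
    using obtain_kernel[OF c(1)] .
  obtain e where e: "e \<in> Hom C X I" "m \<cdot> e = f"
    using kernel_lift[OF m(2) c(1) m(1) f c(3)] .
  note [simp] = HomD[OF f] HomD[OF c(1)] HomD[OF m(1)] HomD[OF e(1)]
    Hom_objects[OF f] Hom_objects[OF e(1)] Hom_objects[OF c(1)]
  have "epic C e"
    unfolding epic_iff_zero[OF e(1)]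
  proof (intro allI ballI impI)
    fix W u assume u: "u \<in> Hom C I W" "u \<cdot> e = Zero C X W"
    \<comment> \<open>The arrow factors through the subobject \<open>m \<cdot> k\<close> of its image, which is the kernel of
      some \<open>g\<close>; then \<open>g\<close> vanishes on the image, so that \<open>m \<cdot> k\<close> is all of it.\<close>
    obtain K k where k: "k \<in> Hom C K I" "is_kernel C u k" "u \<cdot> k = Zero C K W" "monic C k"
      using obtain_kernel[OF u(1)] .
    obtain e' where e': "e' \<in> Hom C X K" "k \<cdot> e' = e"
      using kernel_lift[OF k(2) u(1) k(1) e(1) u(2)] .
    have mk: "m \<cdot> k \<in> Hom C K Y" by (rule Comp_in_Hom) fact+
    obtain g where g: "is_kernel C g (m \<cdot> k)"
      using monic_is_kernel monic_Comp[OF m(4) k(4,1) m(1)] by blast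
    define Z where "Z = Cod C g"
    have gH: "g \<in> Hom C Y Z" using g mk by (simp add: is_kernel_def Hom_def Z_def)
    have gmk: "g \<cdot> m \<cdot> k = Zero C K Z" by (rule kernelD) fact+
    note [simp] = HomD[OF u(1)] HomD[OF k(1)] HomD[OF e'(1)] HomD[OF gH]
      Hom_objects[OF u(1)] Hom_objects[OF gH] Hom_objects[OF k(1)]
    have "g \<cdot> f = (g \<cdot> m \<cdot> k) \<cdot> e'" by (simp add: e e')
    also have "\<dots> = Zero C X Z" by (simp only: gmk) simp
    finally obtain g' where g': "g' \<in> Hom C Q Z" "g' \<cdot> c = g"
      using cokernel_factor[OF c(2) f c(1) gH] by metis
    note [simp] = HomD[OF g'(1)]
    have "g \<cdot> m = g' \<cdot> c \<cdot> m" by (subst g'(2)[symmetric]) simp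
    then have "g \<cdot> m = Zero C I Z" by (simp add: m(3))
    then obtain s where s: "s \<in> Hom C I K" "(m \<cdot> k) \<cdot> s = m"
      using kernel_lift[OF g gH mk m(1)] by auto
    note [simp] = HomD[OF s(1)]
    have "m \<cdot> k \<cdot> s = m \<cdot> Ident C I" using s by simp
    then have ks: "k \<cdot> s = Ident C I"
      by (rule monicD[OF m(4)]) (simp_all add: Hom_def)
    have "u = u \<cdot> k \<cdot> s" by (simp add: ks)
    also have "\<dots> = (u \<cdot> k) \<cdot> s" by simp
    also have "\<dots> = Zero C I W" by (simp only: k(3)) simp
    finally show "u = Zero C I W" .
  qed
  then show thesis using that e m by metis
qed

end

section \<open>The torsion pair of a covariantly finite subcategory\<close>

context preadditive_category
begin

lemma left_perpD: "M \<in> left_perp C T \<Longrightarrow> f \<in> Hom C M X \<Longrightarrow> X \<in> T \<Longrightarrow> f = Zero C M X"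
  by (auto simp: left_perp_def)

lemma left_perpI:
  assumes "M \<in> Obj C" "\<And>X f. X \<in> T \<Longrightarrow> f \<in> Hom C M X \<Longrightarrow> f = Zero C M X" "T \<subseteq> Obj C"
  shows "M \<in> left_perp C T"
  using assms unfolding left_perp_def by (fastforce simp: Hom_def)

lemma left_perp_quotient:
  assumes "epic C e" "e \<in> Hom C M N" "M \<in> left_perp C T" "T \<subseteq> Obj C"
  shows "N \<in> left_perp C T"
proof (rule left_perpI)
  fix X f assume f: "X \<in> T" "f \<in> Hom C N X"
  then have "f \<cdot> e = Zero C M X" using assms(2,3) left_perpD Comp_in_Hom by blast
  then show "f = Zero C N X" using assms(1,2) f epic_iff_zero by blast
qed (use assms Hom_objects in blast)+

lemma injective_retract:
  assumes "injective C E" "e \<in> Hom C E I" "s \<in> Hom C I E" "e \<cdot> s = Ident C I"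
  shows "injective C I"
  unfolding injective_def
proof (intro conjI allI impI ballI)
  note [simp] = Hom_simps[OF assms(2)] Hom_simps[OF assms(3)]
  show "I \<in> Obj C" by simp
  fix m f assume m: "monic C m" and f: "f \<in> Hom C (Dom C m) I"
  then have [simp]: "m \<in> Arr C" by (simp add: monic_def)
  note [simp] = Hom_simps[OF f]
  have "s \<cdot> f \<in> Hom C (Dom C m) E" by (simp add: Hom_def)
  then obtain g where g: "g \<in> Hom C (Cod C m) E" "g \<cdot> m = s \<cdot> f"
    using assms(1) m unfolding injective_def by blast
  note [simp] = HomD[OF g(1)]
  have "(e \<cdot> g) \<cdot> m = e \<cdot> s \<cdot> f" by (simp add: g(2))
  also have "\<dots> = f" by (simp add: Comp_eq_extend[OF assms(4)])
  finally show "\<exists>g \<in> Hom C (Cod C m) I. g \<cdot> m = f"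
    by (intro bexI[of _ "e \<cdot> g"]) (simp_all add: Hom_def)
qed

end

locale covariantly_finite_projectives = abelian_category C for C :: "('o, 'm) cat" (structure) +
  fixes T :: "'o set"
  assumes projective_subobject: "\<And>P Q. projective C P \<Longrightarrow> subobject C Q P \<Longrightarrow> projective C Q"
    and additive: "additive_subcategory C T"
    and summands: "closed_under_summands C T"
    and T_projective: "\<And>P. P \<in> T \<Longrightarrow> projective C P"
    and covariantly_finite: "covariantly_finite C T"
begin

lemma T_Obj: "T \<subseteq> Obj C"
  using additive by (simp add: additive_subcategory_def)

lemma T_summand:
  assumes "biproduct C X Y Z i\<^sub>1 i\<^sub>2 p\<^sub>1 p\<^sub>2" "Z \<in> T"
  shows "X \<in> T"
  using summands biproduct_direct_sum[OF assms(1)] assms(2)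
  unfolding closed_under_summands_def by blast

lemma obtain_preenvelope:
  assumes "M \<in> Obj C"
  obtains E i where "i \<in> Hom C M E" "E \<in> T" "preenvelope C T M i"
  using assms covariantly_finite unfolding covariantly_finite_def preenvelope_def Hom_def by blast

lemma preenvelope_extend:
  assumes "preenvelope C T M i" "i \<in> Hom C M E" "X \<in> T" "f \<in> Hom C M X"
  obtains g where "g \<in> Hom C E X" "g \<cdot> i = f"
  using assms unfolding preenvelope_def by (auto simp: Hom_def)

lemma monic_into_T_projective: "monic C m \<Longrightarrow> m \<in> Hom C I X \<Longrightarrow> X \<in> T \<Longrightarrow> projective C I"
  using projective_subobject T_projective unfolding subobject_def by blast

text \<open>
  The image of a preenvelope is projective, being a subobject of an object of \<open>T\<close>; hence the kernel
  is a direct summand, and arrows from the kernel to \<open>T\<close> extend to arrows that factor through the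
  preenvelope.
\<close>

lemma kernel_of_preenvelope_in_left_perp:
  assumes i: "preenvelope C T M i" "i \<in> Hom C M E"
    and m: "m \<in> Hom C I E" "monic C m" and e: "e \<in> Hom C M I" "epic C e" and me: "m \<cdot> e = i"
    and k: "is_kernel C e k" "k \<in> Hom C K M"
  shows "K \<in> left_perp C T"
proof (rule left_perpI)
  show "K \<in> Obj C" using Hom_objects k(2) by blast
  have E: "E \<in> T" using i by (auto simp: preenvelope_def Hom_def)
  obtain s where s: "s \<in> Hom C I M" "e \<cdot> s = Ident C I"
    using projective_section[OF monic_into_T_projective[OF m(2,1) E] e(2,1)] .
  obtain r where "biproduct C K I M k s r e"
    using split_kernel_biproduct[OF e(1) s k] .
  then have r: "r \<in> Hom C M K" "r \<cdot> k = Ident C K" and ek: "e \<cdot> k = Zero C K I"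
    by (simp_all add: biproduct_def)
  fix X x assume X: "X \<in> T" and x: "x \<in> Hom C K X"
  obtain y where y: "y \<in> Hom C E X" "y \<cdot> i = x \<cdot> r"
    using preenvelope_extend[OF i X Comp_in_Hom[OF r(1) x]] .
  note [simp] = Hom_simps[OF r(1)] Hom_simps[OF k(2)] Hom_simps[OF x] Hom_simps[OF y(1)]
    Hom_simps[OF m(1)] Hom_simps[OF e(1)] Hom_simps[OF i(2)]
  have "x = (x \<cdot> r) \<cdot> k" by (simp add: r(2))
  also have "\<dots> = (y \<cdot> m \<cdot> e) \<cdot> k" by (simp only: y(2)[symmetric] me[symmetric])
  also have "\<dots> = Zero C K X" by (simp add: ek)
  finally show "x = Zero C K X" .
qed (fact T_Obj)

lemma obtain_torsion_sequence:
  assumes i: "preenvelope C T M i" "i \<in> Hom C M E"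
  obtains K I k e m where "k \<in> Hom C K M" "is_kernel C e k" "K \<in> left_perp C T"
    "e \<in> Hom C M I" "epic C e" "m \<in> Hom C I E" "monic C m" "m \<cdot> e = i"
proof -
  obtain I e m where me: "e \<in> Hom C M I" "epic C e" "m \<in> Hom C I E" "monic C m" "m \<cdot> e = i"
    using image_factorization[OF i(2)] .
  obtain K k where "k \<in> Hom C K M" "is_kernel C e k"
    using obtain_kernel[OF me(1)] by metis
  then show thesis using that kernel_of_preenvelope_in_left_perp[OF i me(3,4,1,2,5)] me by blast
qed

lemma left_perp_closed_iso: "closed_under_iso C (left_perp C T)"
  unfolding closed_under_iso_def
proof (intro allI impI)
  fix f assume f: "iso_arr C f \<and> Dom C f \<in> left_perp C T"
  then have "f \<in> Hom C (Dom C f) (Cod C f)" by (simp add: iso_arr_def Hom_def)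
  then show "Cod C f \<in> left_perp C T" using left_perp_quotient[OF iso_arr_epic] f T_Obj by blast
qed

lemma Sub_closed_iso: "closed_under_iso C (Sub C T)"
  unfolding closed_under_iso_def
proof (intro allI impI)
  fix f assume f: "iso_arr C f \<and> Dom C f \<in> Sub C T"
  then have fH: "f \<in> Hom C (Dom C f) (Cod C f)" by (simp add: iso_arr_def Hom_def)
  obtain g where g: "g \<in> Hom C (Cod C f) (Dom C f)" "g \<cdot> f = Ident C (Dom C f)"
      "f \<cdot> g = Ident C (Cod C f)"
    using f iso_arrE[OF _ fH] by metis
  then have "iso_arr C g"
    using fH unfolding iso_arr_def by (auto simp: Hom_def)
  obtain X m where m: "X \<in> T" "m \<in> Hom C (Dom C f) X" "monic C m"
    using f unfolding Sub_def subobject_def by blast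
  have "monic C (m \<cdot> g)" by (rule monic_Comp[OF m(3) iso_arr_monic[OF \<open>iso_arr C g\<close>] g(1) m(2)])
  moreover have "m \<cdot> g \<in> Hom C (Cod C f) X" by (rule Comp_in_Hom[OF g(1) m(2)])
  ultimately show "Cod C f \<in> Sub C T"
    using m(1) Hom_objects[OF fH] unfolding Sub_def subobject_def by blast
qed

text \<open>Every object is thus an extension of an object of \<open>Sub C T\<close> by one of \<open>left_perp C T\<close>.\<close>

lemma torsion_pair_left_perp_Sub: "torsion_pair C (left_perp C T) (Sub C T)"
  unfolding torsion_pair_def
proof (intro conjI ballI)
  show "left_perp C T \<subseteq> Obj C" "Sub C T \<subseteq> Obj C" by (auto simp: left_perp_def Sub_def)
  show "closed_under_iso C (left_perp C T)" "closed_under_iso C (Sub C T)"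
    by (fact left_perp_closed_iso, fact Sub_closed_iso)
next
  fix A B assume A: "A \<in> left_perp C T" and B: "B \<in> Sub C T"
  then have [simp]: "A \<in> Obj C" "B \<in> Obj C" by (auto simp: left_perp_def Sub_def)
  obtain X m where m: "X \<in> T" "m \<in> Hom C B X" "monic C m"
    using B unfolding Sub_def subobject_def by blast
  have "f = Zero C A B" if "f \<in> Hom C A B" for f
    using that monic_iff_zero[OF m(2)] m(3) left_perpD[OF A Comp_in_Hom[OF that m(2)] m(1)] by blast
  moreover have "Zero C A B \<in> Hom C A B" by (simp add: Hom_def)
  ultimately show "Hom C A B = {Zero C A B}" by blast
next
  fix M assume "M \<in> Obj C"
  then obtain E i where i: "i \<in> Hom C M E" "E \<in> T" "preenvelope C T M i"
    using obtain_preenvelope by blast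
  obtain K I k e m where d: "k \<in> Hom C K M" "is_kernel C e k" "K \<in> left_perp C T"
    "e \<in> Hom C M I" "epic C e" "m \<in> Hom C I E" "monic C m" "m \<cdot> e = i"
    using obtain_torsion_sequence[OF i(3,1)] .
  have "short_exact C k e" using d epic_cokernel_of_kernel by (simp add: short_exact_def)
  moreover have "I \<in> Sub C T"
    using d(6,7) i(2) Hom_objects[OF d(6)] unfolding Sub_def subobject_def by blast
  ultimately show "\<exists>f g. short_exact C f g \<and> Cod C f = M \<and> Dom C f \<in> left_perp C T \<and> Cod C g \<in> Sub C T"
    using HomD[OF d(1)] HomD[OF d(4)] d(3) by (intro exI[of _ k] exI[of _ e]) simp
qed

text \<open>
  The sequences split because the objects of \<open>Sub C T\<close> are projective.
\<close>

lemma split_torsion_pair_left_perp_Sub: "split_torsion_pair C (left_perp C T) (Sub C T)"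
  unfolding split_torsion_pair_def
proof (intro conjI allI impI torsion_pair_left_perp_Sub)
  fix f g assume "short_exact C f g \<and> Dom C f \<in> left_perp C T \<and> Cod C g \<in> Sub C T"
  then have k: "is_kernel C g f" and "is_cokernel C f g" and "Cod C g \<in> Sub C T"
    by (auto simp: short_exact_def)
  have P: "projective C (Cod C g)"
    using \<open>Cod C g \<in> Sub C T\<close> monic_into_T_projective unfolding Sub_def subobject_def by blast
  have H: "g \<in> Hom C (Cod C f) (Cod C g)" "f \<in> Hom C (Dom C f) (Cod C f)"
    using k by (auto simp: is_kernel_def Hom_def)
  obtain s where s: "s \<in> Hom C (Cod C g) (Cod C f)" "g \<cdot> s = Ident C (Cod C g)"
    using projective_section[OF P cokernel_epic[OF \<open>is_cokernel C f g\<close>] H(1)] .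
  obtain r where "biproduct C (Dom C f) (Cod C g) (Cod C f) f s r g"
    using split_kernel_biproduct[OF H(1) s k H(2)] .
  then show "\<exists>r \<in> Hom C (Cod C f) (Dom C f). r \<cdot> f = Ident C (Dom C f)"
    unfolding biproduct_def by blast
qed

text \<open>Subobjects on which a preenvelope vanishes are subobjects of its kernel.\<close>

lemma left_perp_subobject:
  assumes closed: "closed_under_subobjects C (left_perp C T)"
    and i: "preenvelope C T M i" "i \<in> Hom C M E"
    and x: "x \<in> Hom C L M" "monic C x" "i \<cdot> x = Zero C L E"
  shows "L \<in> left_perp C T"
proof -
  obtain K I k e m where d: "k \<in> Hom C K M" "is_kernel C e k" "K \<in> left_perp C T"
    "e \<in> Hom C M I" "epic C e" "m \<in> Hom C I E" "monic C m" "m \<cdot> e = i"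
    using obtain_torsion_sequence[OF i] .
  note [simp] = Hom_simps[OF x(1)] Hom_simps[OF d(1)] Hom_simps[OF d(4)] Hom_simps[OF d(6)]
  have "m \<cdot> e \<cdot> x = Zero C L E" using x(3) d(8) by (simp flip: Comp_assoc_Arr)
  then have "e \<cdot> x = Zero C L I"
    using monic_iff_zero[OF d(6)] d(7) Comp_in_Hom[OF x(1) d(4)] by blast
  then obtain y where y: "y \<in> Hom C L K" "k \<cdot> y = x"
    using kernel_lift[OF d(2,4,1) x(1)] by metis
  note [simp] = HomD[OF y(1)]
  have "monic C y"
    unfolding monic_iff_zero[OF y(1)]
  proof (intro allI ballI impI)
    fix W u assume u: "u \<in> Hom C W L" "y \<cdot> u = Zero C W K"
    note [simp] = Hom_simps[OF u(1)]
    have "x \<cdot> u = k \<cdot> y \<cdot> u" by (simp add: y(2)[symmetric])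
    also have "\<dots> = Zero C W M" by (simp add: u(2))
    finally show "u = Zero C W L" using monic_iff_zero[OF x(1)] x(2) u(1) by blast
  qed
  then show ?thesis
    using closed d(3) y(1) unfolding closed_under_subobjects_def subobject_def by blast
qed

text \<open>
  The torsion-free part of an injective object containing \<open>X\<close> still contains \<open>X\<close>, since the torsion
  part meets \<open>X\<close> in an object whose inclusion into \<open>X\<close> has to be zero.
\<close>

lemma embeds_in_injective_if_closed:
  assumes closed: "closed_under_subobjects C (left_perp C T)" and "enough_injectives C" "X \<in> T"
  shows "\<exists>E \<in> T. injective C E \<and> subobject C X E"
proof -
  have X: "X \<in> Obj C" using T_Obj assms(3) by blast
  obtain E j where E: "injective C E" "j \<in> Hom C X E" "monic C j"
    using assms(2) X unfolding enough_injectives_def subobject_def by blast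
  obtain F i where i: "i \<in> Hom C E F" "F \<in> T" "preenvelope C T E i"
    using obtain_preenvelope Hom_objects[OF E(2)] by blast
  \<comment> \<open>The part of \<open>X\<close> that \<open>i\<close> kills lies in the left perpendicular category, so its inclusion
    into \<open>X\<close> vanishes.\<close>
  have "monic C (i \<cdot> j)"
  proof -
    have ij: "i \<cdot> j \<in> Hom C X F" by (rule Comp_in_Hom[OF E(2) i(1)])
    obtain L l where l: "l \<in> Hom C L X" "is_kernel C (i \<cdot> j) l" "(i \<cdot> j) \<cdot> l = Zero C L F" "monic C l"
      using obtain_kernel[OF ij] .
    note [simp] = Hom_simps[OF E(2)] Hom_simps[OF i(1)] Hom_simps[OF l(1)]
    have "j \<cdot> l \<in> Hom C L E" "monic C (j \<cdot> l)" "i \<cdot> j \<cdot> l = Zero C L F"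
      using Comp_in_Hom[OF l(1) E(2)] monic_Comp[OF E(3) l(4,1) E(2)] l(3) by simp_all
    then have "L \<in> left_perp C T" by (rule left_perp_subobject[OF closed i(3,1)])
    then have l0: "l = Zero C L X" using left_perpD l(1) assms(3) by blast
    show ?thesis
      unfolding monic_iff_zero[OF ij]
    proof (intro allI ballI impI)
      fix W u assume u: "u \<in> Hom C W X" "(i \<cdot> j) \<cdot> u = Zero C W F"
      obtain y where y: "y \<in> Hom C W L" "l \<cdot> y = u" using kernel_lift[OF l(2) ij l(1) u] .
      then show "u = Zero C W X" using Hom_simps[OF y(1)] by (simp add: l0)
    qed
  qed
  \<comment> \<open>The image of \<open>i\<close> is projective, hence a summand of \<open>E\<close>, hence injective, hence a summand
    of \<open>F\<close>.\<close>
  obtain I e m where me: "e \<in> Hom C E I" "epic C e" "m \<in> Hom C I F" "monic C m" "m \<cdot> e = i"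
    using image_factorization[OF i(1)] .
  obtain s where s: "s \<in> Hom C I E" "e \<cdot> s = Ident C I"
    using projective_section[OF monic_into_T_projective[OF me(4,3) i(2)] me(2,1)] .
  have I: "injective C I" by (rule injective_retract[OF E(1) me(1) s])
  have IO: "I \<in> Obj C" using Hom_objects[OF s(1)] by blast
  obtain t where t: "t \<in> Hom C F I" "t \<cdot> m = Ident C I"
    using I me(3,4) Ident_in_Hom[OF IO] unfolding injective_def Hom_def by blast
  obtain L l where l: "l \<in> Hom C L F" "is_kernel C t l" using obtain_kernel[OF t(1)] by metis
  obtain r where "biproduct C L I F l m r t"
    using split_kernel_biproduct[OF t(1) me(3) t(2) l(2,1)] .
  then have "I \<in> T" using T_summand[OF biproduct_commute] i(2) by blast
  moreover have "subobject C X I"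
  proof -
    note [simp] = Hom_simps[OF E(2)] Hom_simps[OF me(1)] Hom_simps[OF me(3)]
    have ej: "e \<cdot> j \<in> Hom C X I" by (rule Comp_in_Hom[OF E(2) me(1)])
    have "monic C (e \<cdot> j)"
      unfolding monic_iff_zero[OF ej]
    proof (intro allI ballI impI)
      fix W u assume u: "u \<in> Hom C W X" "(e \<cdot> j) \<cdot> u = Zero C W I"
      note [simp] = Hom_simps[OF u(1)]
      have "(i \<cdot> j) \<cdot> u = m \<cdot> (e \<cdot> j) \<cdot> u" by (simp add: me(5)[symmetric])
      also have "\<dots> = Zero C W F" by (simp only: u(2)) simp
      finally show "u = Zero C W X"
        using \<open>monic C (i \<cdot> j)\<close> monic_iff_zero[OF Comp_in_Hom[OF E(2) i(1)]] u(1) by blast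
    qed
    then show ?thesis using ej unfolding subobject_def by blast
  qed
  ultimately show ?thesis using I by blast
qed

text \<open>
  An arrow from a subobject to \<open>T\<close> extends to the whole object once its target is embedded into an
  injective object of \<open>T\<close>, where the extension has to vanish.
\<close>

lemma closed_if_embeds_in_injective:
  assumes "\<And>X. X \<in> T \<Longrightarrow> \<exists>E \<in> T. injective C E \<and> subobject C X E"
  shows "closed_under_subobjects C (left_perp C T)"
  unfolding closed_under_subobjects_def
proof (intro ballI allI impI)
  fix Y X assume X: "X \<in> left_perp C T" and "subobject C Y X"
  then obtain m where m: "m \<in> Hom C Y X" "monic C m" unfolding subobject_def by blast
  show "Y \<in> left_perp C T"
  proof (rule left_perpI)
    fix F f assume F: "F \<in> T" and f: "f \<in> Hom C Y F"
    obtain E j where E: "E \<in> T" "injective C E" "j \<in> Hom C F E" "monic C j"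
      using assms[OF F] unfolding subobject_def by blast
    have D: "Dom C m = Y" "Cod C m = X" using m(1) by (simp_all add: Hom_def)
    have "j \<cdot> f \<in> Hom C (Dom C m) E" unfolding D by (rule Comp_in_Hom[OF f E(3)])
    then obtain g where g: "g \<in> Hom C X E" "g \<cdot> m = j \<cdot> f"
      using E(2) m(2) D unfolding injective_def by metis
    have "g = Zero C X E" by (rule left_perpD[OF X g(1) E(1)])
    then have "j \<cdot> f = Zero C Y E"
      using g(2) Hom_simps[OF m(1)] Hom_simps[OF E(3)] by simp
    then show "f = Zero C Y F" using monic_iff_zero[OF E(3)] E(4) f by blast
  qed (use Hom_objects[OF m(1)] T_Obj in auto)
qed

end

section \<open>Stable categories\<close>

lemma factors_through_opposite [simp]:
  "factors_through (opposite D) T f \<longleftrightarrow> factors_through D T f"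
  unfolding factors_through_def by auto

lemma stable_class_opposite [simp]: "stable_class (opposite D) T f = stable_class D T f"
  by (simp add: stable_class_def Diff_def)

lemma stable_category_opposite [simp]:
  "stable_category (opposite D) T = opposite (stable_category D T)"
proof -
  have "stable_class (opposite D) T = stable_class D T" by (rule ext) simp
  then show ?thesis by (simp add: stable_category_def Let_def) (simp add: opposite_def)
qed

locale stable_quotient = preadditive_category C for C :: "('o, 'm) cat" (structure) +
  fixes T :: "'o set"
  assumes additive_T: "additive_subcategory C T"
begin

abbreviation S where "S \<equiv> stable_category C T"
abbreviation fac where "fac \<equiv> factors_through C T"
abbreviation cls where "cls \<equiv> stable_class C T"

lemma T_subset_Obj: "T \<subseteq> Obj C"
  using additive_T by (simp add: additive_subcategory_def)

lemma facI: "E \<in> T \<Longrightarrow> u \<in> Hom C X E \<Longrightarrow> v \<in> Hom C E Y \<Longrightarrow> fac (v \<cdot> u)"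
  unfolding factors_through_def by (auto simp: Hom_def)

lemma facE:
  assumes "fac f" "f \<in> Hom C X Y"
  obtains E u v where "E \<in> T" "u \<in> Hom C X E" "v \<in> Hom C E Y" "f = v \<cdot> u"
  using assms unfolding factors_through_def by (auto simp: Hom_def)

lemma fac_Comp:
  assumes "f \<in> Hom C X Y" "g \<in> Hom C Y Z"
  shows "fac f \<Longrightarrow> fac (g \<cdot> f)" "fac g \<Longrightarrow> fac (g \<cdot> f)"
proof -
  assume "fac f"
  then obtain E u v where E: "E \<in> T" "u \<in> Hom C X E" "v \<in> Hom C E Y" "f = v \<cdot> u"
    using facE assms(1) by blast
  then have "fac ((g \<cdot> v) \<cdot> u)" using facI Comp_in_Hom[OF E(3) assms(2)] by blast
  then show "fac (g \<cdot> f)" using Comp_assoc[OF E(2,3) assms(2)] E(4) by simp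
next
  assume "fac g"
  then obtain E u v where E: "E \<in> T" "u \<in> Hom C Y E" "v \<in> Hom C E Z" "g = v \<cdot> u"
    using facE assms(2) by blast
  then have "fac (v \<cdot> u \<cdot> f)" using facI Comp_in_Hom[OF assms(1) E(2)] by blast
  then show "fac (g \<cdot> f)" using Comp_assoc[OF assms(1) E(2,3)] E(4) by simp
qed

lemma fac_Zero: "X \<in> Obj C \<Longrightarrow> Y \<in> Obj C \<Longrightarrow> fac (Zero C X Y)"
proof -
  assume XY [simp]: "X \<in> Obj C" "Y \<in> Obj C"
  obtain E where E: "E \<in> T" using additive_T by (auto simp: additive_subcategory_def)
  then have [simp]: "E \<in> Obj C" using T_subset_Obj by blast
  have "fac (Zero C E Y \<cdot> Zero C X E)"
    by (rule facI[OF E, of _ X _ Y]) (simp_all add: Hom_def)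
  then show ?thesis by simp
qed

lemma fac_neg:
  assumes "fac f" "f \<in> Hom C X Y"
  shows "fac (neg f)"
proof -
  obtain E u v where E: "E \<in> T" "u \<in> Hom C X E" "v \<in> Hom C E Y" "f = v \<cdot> u"
    using facE assms by blast
  then have "fac (neg v \<cdot> u)" by (intro facI) (simp_all add: Hom_def)
  then show ?thesis using E by (simp add: Hom_def)
qed

text \<open>
  Two factorizations combine into one through the direct sum of the objects of \<open>T\<close>.
\<close>

lemma fac_Plus:
  assumes "fac f" "f \<in> Hom C X Y" "fac g" "g \<in> Hom C X Y"
  shows "fac (f \<oplus> g)"
proof -
  obtain E u v where E: "E \<in> T" "u \<in> Hom C X E" "v \<in> Hom C E Y" "f = v \<cdot> u"
    using facE assms(1,2) by blast
  obtain F u' v' where F: "F \<in> T" "u' \<in> Hom C X F" "v' \<in> Hom C F Y" "g = v' \<cdot> u'"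
    using facE assms(3,4) by blast
  obtain Z i\<^sub>1 i\<^sub>2 p\<^sub>1 p\<^sub>2 where Z: "Z \<in> T" and bp: "biproduct C E F Z i\<^sub>1 i\<^sub>2 p\<^sub>1 p\<^sub>2"
    using additive_T E(1) F(1) unfolding additive_subcategory_def is_direct_sum_def by metis
  note D = biproductD[OF bp]
  note [simp] = Hom_simps[OF E(2)] Hom_simps[OF E(3)] Hom_simps[OF F(2)] Hom_simps[OF F(3)]
    HomD[OF D(1)] HomD[OF D(2)] HomD[OF D(3)] HomD[OF D(4)] D(5-8)
    Comp_eq_extend[OF D(5)] Comp_eq_extend[OF D(6)] Comp_eq_extend[OF D(7)] Comp_eq_extend[OF D(8)]
  have "fac ((v \<cdot> p\<^sub>1 \<oplus> v' \<cdot> p\<^sub>2) \<cdot> (i\<^sub>1 \<cdot> u \<oplus> i\<^sub>2 \<cdot> u'))"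
    by (rule facI[OF Z, of _ X _ Y]) (simp_all add: Hom_def)
  also have "(v \<cdot> p\<^sub>1 \<oplus> v' \<cdot> p\<^sub>2) \<cdot> (i\<^sub>1 \<cdot> u \<oplus> i\<^sub>2 \<cdot> u') = f \<oplus> g"
    by (simp add: E(4) F(4))
  finally show ?thesis .
qed

lemma stable_class_iff:
  assumes "f \<in> Hom C X Y"
  shows "g \<in> cls f \<longleftrightarrow> g \<in> Hom C X Y \<and> fac (f \<oplus> neg g)"
  using assms by (auto simp: stable_class_def Diff_def neg_def Hom_def)

lemma fac_diff_iff:
  assumes "f \<in> Hom C X Y" "g \<in> Hom C X Y"
  shows "fac (f \<oplus> neg g) \<longleftrightarrow> (\<exists>d \<in> Hom C X Y. fac d \<and> f = g \<oplus> d)"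
proof
  assume "fac (f \<oplus> neg g)"
  then show "\<exists>d \<in> Hom C X Y. fac d \<and> f = g \<oplus> d"
    using assms diff_eq_iff[of f g "f \<oplus> neg g"]
    by (intro bexI[of _ "f \<oplus> neg g"]) (simp_all add: Hom_def)
next
  assume "\<exists>d \<in> Hom C X Y. fac d \<and> f = g \<oplus> d"
  then obtain d where d: "d \<in> Hom C X Y" "fac d" "f = g \<oplus> d" by blast
  then have "f \<oplus> neg g = d" using assms diff_eq_iff[of f g d] by (simp add: Hom_def)
  then show "fac (f \<oplus> neg g)" using d by simp
qed

lemma fac_diff_sym:
  assumes "f \<in> Hom C X Y" "g \<in> Hom C X Y" "fac (f \<oplus> neg g)"
  shows "fac (g \<oplus> neg f)"
proof -
  obtain d where d: "d \<in> Hom C X Y" "fac d" "f = g \<oplus> d" using fac_diff_iff assms by blast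
  have "g = f \<oplus> neg d"
    using assms d by (simp add: Hom_def Plus_assoc Plus_neg)
  then show ?thesis using fac_diff_iff assms(1,2) fac_neg d(1,2)
    by (metis (no_types, lifting) Hom_def mem_Collect_eq neg_laws(1-3))
qed

lemma fac_diff_trans:
  assumes "f \<in> Hom C X Y" "g \<in> Hom C X Y" "h \<in> Hom C X Y" "fac (f \<oplus> neg g)" "fac (g \<oplus> neg h)"
  shows "fac (f \<oplus> neg h)"
proof -
  obtain d where d: "d \<in> Hom C X Y" "fac d" "f = g \<oplus> d" using fac_diff_iff assms by blast
  obtain d' where d': "d' \<in> Hom C X Y" "fac d'" "g = h \<oplus> d'" using fac_diff_iff assms by blast
  have "f = h \<oplus> (d' \<oplus> d)"
    using assms d d' by (simp add: Hom_def Plus_assoc)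
  moreover have "d' \<oplus> d \<in> Hom C X Y" using d d' by (simp add: Hom_def)
  ultimately show ?thesis using fac_diff_iff[OF assms(1,3)] fac_Plus d d' by blast
qed

lemma stable_eq_iff:
  assumes "f \<in> Hom C X Y" "g \<in> Hom C X Y"
  shows "cls f = cls g \<longleftrightarrow> fac (f \<oplus> neg g)"
proof
  have "fac (g \<oplus> neg g)"
    using fac_Zero[of X Y] Hom_simps[OF assms(2)] by (simp add: Plus_neg)
  then have "g \<in> cls g" using stable_class_iff[OF assms(2)] assms(2) by blast
  then show "fac (f \<oplus> neg g)" if "cls f = cls g" using that stable_class_iff[OF assms(1)] by blast
next
  assume "fac (f \<oplus> neg g)"
  then have "h \<in> cls f \<longleftrightarrow> h \<in> cls g" for h
    using stable_class_iff[OF assms(1)] stable_class_iff[OF assms(2)] assms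
      fac_diff_sym fac_diff_trans by blast
  then show "cls f = cls g" by blast
qed

lemma stable_eqI:
  assumes "f \<in> Hom C X Y" "g \<in> Hom C X Y" "d \<in> Hom C X Y" "fac d" "f = g \<oplus> d"
  shows "cls f = cls g"
  using stable_eq_iff[OF assms(1,2)] fac_diff_iff[OF assms(1,2)] assms by blast

lemma stable_eqE:
  assumes "cls f = cls g" "f \<in> Hom C X Y" "g \<in> Hom C X Y"
  obtains d where "d \<in> Hom C X Y" "fac d" "f = g \<oplus> d"
  using stable_eq_iff[OF assms(2,3)] fac_diff_iff[OF assms(2,3)] assms(1) by blast

lemma stable_Zero_iff:
  assumes "f \<in> Hom C X Y"
  shows "cls f = cls (Zero C X Y) \<longleftrightarrow> fac f"
proof -
  have "Zero C X Y \<in> Hom C X Y" using Hom_simps[OF assms] by (simp add: Hom_def)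
  then show ?thesis using stable_eq_iff[OF assms] Hom_simps[OF assms] by simp
qed

lemma stable_Comp_cong:
  assumes "f \<in> Hom C X Y" "f' \<in> Hom C X Y" "g \<in> Hom C Y Z" "g' \<in> Hom C Y Z"
    and "cls f = cls f'" "cls g = cls g'"
  shows "cls (g \<cdot> f) = cls (g' \<cdot> f')"
proof -
  obtain d where d: "d \<in> Hom C X Y" "fac d" "f = f' \<oplus> d" using stable_eqE assms by metis
  obtain e where e: "e \<in> Hom C Y Z" "fac e" "g = g' \<oplus> e" using stable_eqE assms by metis
  note [simp] = HomD[OF assms(2)] HomD[OF assms(4)] HomD[OF d(1)] HomD[OF e(1)]
  have "g \<cdot> f = g' \<cdot> f' \<oplus> (e \<cdot> f' \<oplus> g \<cdot> d)"
    by (simp add: d(3) e(3) Plus_assoc)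
  moreover have "fac (e \<cdot> f')" by (rule fac_Comp(2)) fact+
  moreover have "fac (g \<cdot> d)" by (rule fac_Comp(1)) fact+
  moreover have "e \<cdot> f' \<in> Hom C X Z" "g \<cdot> d \<in> Hom C X Z" using Comp_in_Hom assms d e by blast+
  ultimately show ?thesis
    using assms Comp_in_Hom by (intro stable_eqI[of _ X Z _ "e \<cdot> f' \<oplus> g \<cdot> d"] fac_Plus)
      (auto simp: Hom_def)
qed

text \<open>
  The operations of the stable category are defined by chosen representatives of classes.
\<close>

lemma some_representative:
  assumes "f \<in> Hom C X Y"
  shows "(SOME g. g \<in> cls f) \<in> Hom C X Y" "cls (SOME g. g \<in> cls f) = cls f"
proof -
  have "fac (f \<oplus> neg f)"
    using fac_Zero[of X Y] Hom_simps[OF assms] by (simp add: Plus_neg)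
  then have "f \<in> cls f" using stable_class_iff[OF assms] assms by blast
  then have "(SOME g. g \<in> cls f) \<in> cls f" by (rule someI)
  then show "(SOME g. g \<in> cls f) \<in> Hom C X Y" "cls (SOME g. g \<in> cls f) = cls f"
    using stable_class_iff[OF assms] stable_eq_iff[OF assms] by blast+
qed

lemma stable_Obj [simp]: "Obj S = Obj C"
  and stable_Ident [simp]: "Ident S X = cls (Ident C X)"
  and stable_Arr: "Arr S = cls ` Arr C"
  by (simp_all add: stable_category_def Let_def)

lemma stable_Dom_Cod:
  assumes "f \<in> Hom C X Y"
  shows "Dom S (cls f) = X" "Cod S (cls f) = Y"
  using some_representative(1)[OF assms] by (simp_all add: stable_category_def Let_def Hom_def)

lemma stable_Hom: "Hom S X Y = cls ` Hom C X Y"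
proof
  show "Hom S X Y \<subseteq> cls ` Hom C X Y"
  proof
    fix a assume a: "a \<in> Hom S X Y"
    then obtain f where f: "f \<in> Arr C" "a = cls f" by (auto simp: Hom_def stable_Arr)
    then have fH: "f \<in> Hom C (Dom C f) (Cod C f)" by (simp add: Hom_def)
    have "Dom C f = X" "Cod C f = Y" using stable_Dom_Cod[OF fH] a f by (simp_all add: Hom_def)
    then show "a \<in> cls ` Hom C X Y" using f fH by blast
  qed
  show "cls ` Hom C X Y \<subseteq> Hom S X Y"
    using stable_Dom_Cod by (auto simp: Hom_def stable_Arr)
qed

lemma stable_HomI: "f \<in> Hom C X Y \<Longrightarrow> cls f \<in> Hom S X Y"
  by (simp add: stable_Hom)

lemma stable_HomE:
  assumes "a \<in> Hom S X Y"
  obtains f where "f \<in> Hom C X Y" "a = cls f"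
  using assms by (auto simp: stable_Hom)

lemma stable_Comp:
  assumes "f \<in> Hom C X Y" "g \<in> Hom C Y Z"
  shows "cls g \<cdot>\<^bsub>S\<^esub> cls f = cls (g \<cdot> f)"
  using stable_Comp_cong[OF some_representative(1)[OF assms(1)] assms(1)
      some_representative(1)[OF assms(2)] assms(2)] some_representative(2) assms
  by (simp add: stable_category_def Let_def)

lemma category_stable: "category S"
proof
  fix a assume "a \<in> Arr S"
  then have "a \<in> Hom S (Dom S a) (Cod S a)" by (simp add: Hom_def)
  then obtain f where "f \<in> Hom C (Dom S a) (Cod S a)" by (rule stable_HomE)
  then show "Dom S a \<in> Obj S" "Cod S a \<in> Obj S" using Hom_objects by simp_all
next
  fix X assume "X \<in> Obj S"
  then show "Ident S X \<in> Hom S X X" using stable_HomI Ident_in_Hom by simp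
next
  fix a b X Y Z assume ab: "a \<in> Hom S X Y" "b \<in> Hom S Y Z"
  obtain f where f: "f \<in> Hom C X Y" "a = cls f" using ab(1) by (rule stable_HomE)
  obtain g where g: "g \<in> Hom C Y Z" "b = cls g" using ab(2) by (rule stable_HomE)
  show "b \<cdot>\<^bsub>S\<^esub> a \<in> Hom S X Z"
    using stable_Comp[OF f(1) g(1)] stable_HomI[OF Comp_in_Hom[OF f(1) g(1)]] f(2) g(2) by simp
next
  fix a X Y assume "a \<in> Hom S X Y"
  then obtain f where f: "f \<in> Hom C X Y" "a = cls f" by (rule stable_HomE)
  show "a \<cdot>\<^bsub>S\<^esub> Ident S X = a" "Ident S Y \<cdot>\<^bsub>S\<^esub> a = a"
    using f stable_Comp[OF Ident_in_Hom f(1)] stable_Comp[OF f(1) Ident_in_Hom]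
      Hom_objects[OF f(1)] Comp_Ident[OF f(1)] Ident_Comp[OF f(1)] by simp_all
next
  fix a b c W X Y Z assume abc: "a \<in> Hom S W X" "b \<in> Hom S X Y" "c \<in> Hom S Y Z"
  obtain f where f: "f \<in> Hom C W X" "a = cls f" using abc(1) by (rule stable_HomE)
  obtain g where g: "g \<in> Hom C X Y" "b = cls g" using abc(2) by (rule stable_HomE)
  obtain h where h: "h \<in> Hom C Y Z" "c = cls h" using abc(3) by (rule stable_HomE)
  show "(c \<cdot>\<^bsub>S\<^esub> b) \<cdot>\<^bsub>S\<^esub> a = c \<cdot>\<^bsub>S\<^esub> b \<cdot>\<^bsub>S\<^esub> a"
    using f g h Comp_in_Hom[OF f(1) g(1)] Comp_in_Hom[OF g(1) h(1)]
    by (simp add: stable_Comp[of _ W X] stable_Comp[of _ X Y] stable_Comp[of _ W Y]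
        Comp_assoc[OF f(1) g(1) h(1)])
qed

lemma stable_monicI:
  assumes f: "f \<in> Hom C X Y"
    and "\<And>W u. u \<in> Hom C W X \<Longrightarrow> fac (f \<cdot> u) \<Longrightarrow> fac u"
  shows "monic S (cls f)"
  unfolding monic_def
proof (intro conjI allI ballI impI)
  show "cls f \<in> Arr S" using f by (auto simp: stable_Arr Hom_def)
  fix W a b assume "a \<in> Hom S W (Dom S (cls f))" "b \<in> Hom S W (Dom S (cls f))"
    and eq: "cls f \<cdot>\<^bsub>S\<^esub> a = cls f \<cdot>\<^bsub>S\<^esub> b"
  then have ab: "a \<in> Hom S W X" "b \<in> Hom S W X" by (simp_all add: stable_Dom_Cod[OF f])
  obtain u where u: "u \<in> Hom C W X" "a = cls u" using ab(1) by (rule stable_HomE)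
  obtain v where v: "v \<in> Hom C W X" "b = cls v" using ab(2) by (rule stable_HomE)
  have "cls (f \<cdot> u) = cls (f \<cdot> v)" using eq u v stable_Comp f by simp
  then have "fac (f \<cdot> u \<oplus> neg (f \<cdot> v))" using stable_eq_iff Comp_in_Hom[OF _ f] u v by blast
  then have "fac (f \<cdot> (u \<oplus> neg v))"
    using f u(1) v(1) by (simp add: Hom_def)
  then have "fac (u \<oplus> neg v)"
    using assms(2)[of "u \<oplus> neg v" W] u(1) v(1) by (simp add: Hom_def)
  then show "a = b" using u v stable_eq_iff by blast
qed

lemma stable_monicD:
  assumes "monic S (cls f)" "f \<in> Hom C X Y" "u \<in> Hom C W X" "fac (f \<cdot> u)"
  shows "fac u"
proof -
  have Z: "Zero C W X \<in> Hom C W X" using Hom_simps[OF assms(3)] by (simp add: Hom_def)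
  have "cls (f \<cdot> u) = cls (Zero C W Y)"
    using stable_Zero_iff[OF Comp_in_Hom[OF assms(3,2)]] assms(4) by simp
  also have "\<dots> = cls (f \<cdot> Zero C W X)" using Hom_simps[OF assms(2)] Hom_simps[OF assms(3)] by simp
  finally have "cls f \<cdot>\<^bsub>S\<^esub> cls u = cls f \<cdot>\<^bsub>S\<^esub> cls (Zero C W X)"
    using stable_Comp assms(2,3) Z by simp
  then have "cls u = cls (Zero C W X)"
    by (rule category.monicD[OF category_stable assms(1), of _ _ W])
      (use assms(2,3) Z in \<open>simp_all add: stable_Dom_Cod stable_HomI\<close>)
  then show ?thesis using stable_Zero_iff assms(3) by blast
qed

lemma fac_if_endpoint:
  assumes "f \<in> Hom C X Y" "X \<in> T \<or> Y \<in> T"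
  shows "fac f"
  using assms(2)
proof
  assume "X \<in> T"
  then show ?thesis
    using facI[OF _ Ident_in_Hom assms(1)] Hom_objects[OF assms(1)] Comp_Ident[OF assms(1)] by metis
next
  assume "Y \<in> T"
  then show ?thesis
    using facI[OF _ assms(1) Ident_in_Hom] Hom_objects[OF assms(1)] Ident_Comp[OF assms(1)] by metis
qed

lemma zero_object_stable:
  assumes E: "E \<in> T"
  shows "zero_object S E"
proof -
  have [simp]: "E \<in> Obj C" using T_subset_Obj E by blast
  have "Hom S X Y = {cls (Zero C X Y)}" if "X = E \<or> Y = E" "X \<in> Obj C" "Y \<in> Obj C" for X Y
  proof -
    have "Zero C X Y \<in> Hom C X Y" using that by (simp add: Hom_def)
    moreover have "cls f = cls (Zero C X Y)" if "f \<in> Hom C X Y" for f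
      using stable_Zero_iff[OF that] fac_if_endpoint[OF that] \<open>X = E \<or> Y = E\<close> E by blast
    ultimately show ?thesis unfolding stable_Hom by blast
  qed
  then show ?thesis unfolding zero_object_def by simp
qed

end

section \<open>Triangles with a zero object\<close>

lemma (in category) epic_iso_transfer:
  assumes a: "a \<in> Hom C A B" and f: "f \<in> Hom C L M" and x: "x \<in> Hom C A L" and y: "y \<in> Hom C B M"
    and eq: "y \<cdot> a = f \<cdot> x" and iso: "iso_arr C x" "iso_arr C y" and f_epic: "epic C f"
  shows "epic C a"
proof -
  obtain x' where x': "x' \<in> Hom C L A" "x \<cdot> x' = Ident C L"
    using iso_arrE[OF iso(1) x] by metis
  obtain y' where y': "y' \<in> Hom C M B" "y' \<cdot> y = Ident C B"
    using iso_arrE[OF iso(2) y] by metis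
  note [simp] = Hom_simps[OF a] Hom_simps[OF f] HomD[OF x] HomD[OF y] HomD[OF x'(1)] HomD[OF y'(1)]
    x'(2) y'(2)
  have key: "(u \<cdot> y') \<cdot> f = (u \<cdot> a) \<cdot> x'" if "u \<in> Hom C B W" for u W
  proof -
    note [simp] = HomD[OF that]
    have "(u \<cdot> y') \<cdot> f = u \<cdot> y' \<cdot> (f \<cdot> x) \<cdot> x'" by simp
    also have "\<dots> = (u \<cdot> a) \<cdot> x'"
      by (simp only: eq[symmetric]) (simp add: Comp_eq_extend[OF y'(2)])
    finally show ?thesis .
  qed
  show ?thesis
    unfolding epic_def
  proof (intro conjI allI ballI impI)
    show "a \<in> Arr C" by simp
    fix W u v assume "u \<in> Hom C (Cod C a) W" "v \<in> Hom C (Cod C a) W" and e: "u \<cdot> a = v \<cdot> a"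
    then have uv: "u \<in> Hom C B W" "v \<in> Hom C B W" by simp_all
    note [simp] = HomD[OF uv(1)] HomD[OF uv(2)]
    have "(u \<cdot> y') \<cdot> f = (v \<cdot> y') \<cdot> f" using key[OF uv(1)] key[OF uv(2)] e by simp
    then have "u \<cdot> y' = v \<cdot> y'"
      by (rule epicD[OF f_epic, of _ _ W]) (simp_all add: Hom_def)
    then have "(u \<cdot> y') \<cdot> y = (v \<cdot> y') \<cdot> y" by (rule arg_cong)
    then show "u = v" by simp
  qed
qed

lemma preenvelope_opposite [simp]: "preenvelope (opposite D) T M f \<longleftrightarrow> precover D T M f"
  by (simp add: preenvelope_def precover_def)

lemma suspension_data_opposite [simp]:
  "suspension_data (opposite D) T p k \<longleftrightarrow> loop_data D T p k"
  by (simp add: suspension_data_def loop_data_def)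

context stable_quotient
begin

lemma stable_quotient_opposite: "stable_quotient (opposite C) T"
proof (intro stable_quotient.intro stable_quotient_axioms.intro preadditive_opposite)
  show "additive_subcategory (opposite C) T"
    using additive_T by (simp add: additive_subcategory_def)
qed

lemma stable_epicI:
  assumes "f \<in> Hom C X Y" "\<And>W u. u \<in> Hom C Y W \<Longrightarrow> fac (u \<cdot> f) \<Longrightarrow> fac u"
  shows "epic S (cls f)"
  using stable_quotient.stable_monicI[OF stable_quotient_opposite, of f Y X] assms by simp

lemma stable_epicD:
  assumes "epic S (cls f)" "f \<in> Hom C X Y" "u \<in> Hom C Y W" "fac (u \<cdot> f)"
  shows "fac u"
  using stable_quotient.stable_monicD[OF stable_quotient_opposite, of f Y X u W] assms by simp

lemma suspension_typing:
  assumes "suspension_data C T i c" "L \<in> Obj C"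
  obtains E Q where "i L \<in> Hom C L E" "E \<in> T" "c L \<in> Hom C E Q" "preenvelope C T L (i L)"
    "is_cokernel C (i L) (c L)"
proof -
  have "preenvelope C T L (i L)" "is_cokernel C (i L) (c L)"
    using assms by (auto simp: suspension_data_def)
  then show thesis
    by (intro that[of "Cod C (i L)" "Cod C (c L)"])
      (auto simp: preenvelope_def is_cokernel_def Hom_def)
qed

text \<open>
  If \<open>f\<close> differs from the identity by \<open>v \<cdot> u\<close> with \<open>u = u' \<cdot> i L\<close>, then any lift \<open>t\<close> of \<open>f\<close> agrees
  with \<open>1 + i L \<cdot> v \<cdot> u'\<close> up to an arrow \<open>w \<cdot> c L\<close>.  On the cokernel only \<open>c L \<cdot> w\<close> survives, and
  it factors through \<open>T\<close>.
\<close>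

lemma suspension_arr_Ident:
  assumes "suspension_data C T i c" and L [simp]: "L \<in> Obj C"
  shows "suspension_arr C T i c (cls (Ident C L)) = cls (Ident C (Cod C (c L)))"
proof -
  obtain E Q where i: "i L \<in> Hom C L E" "preenvelope C T L (i L)" and E: "E \<in> T"
    and c: "c L \<in> Hom C E Q" "is_cokernel C (i L) (c L)"
    using suspension_typing[OF assms] .
  note [simp] = Hom_simps[OF i(1)] Hom_simps[OF c(1)]
  have ci: "c L \<cdot> i L = Zero C L Q" by (rule cokernelD[OF c(2) i(1) c(1)])
  have id: "Ident C L \<in> Hom C L L" by (simp add: Hom_def)
  have unique: "cls s = cls (Ident C Q)"
    if f: "f \<in> cls (Ident C L)" and t: "t \<in> Hom C E E" "t \<cdot> i L = i L \<cdot> f"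
      and s: "s \<in> Hom C Q Q" "s \<cdot> c L = c L \<cdot> t" for f t s
  proof -
    have fH: "f \<in> Hom C L L" and "fac (f \<oplus> neg (Ident C L))"
      using f stable_class_iff[OF id] fac_diff_sym[OF id] by auto
    then obtain d where d: "d \<in> Hom C L L" "fac d" "f = Ident C L \<oplus> d"
      using fac_diff_iff[OF fH id] by blast
    obtain F u v where F: "F \<in> T" "u \<in> Hom C L F" "v \<in> Hom C F L" "d = v \<cdot> u"
      using facE[OF d(2,1)] .
    obtain u' where u': "u' \<in> Hom C E F" "u' \<cdot> i L = u"
      using i(2) F(1,2) unfolding preenvelope_def by auto
    note [simp] = HomD[OF F(2)] HomD[OF F(3)] HomD[OF u'(1)] HomD[OF t(1)] HomD[OF s(1)]
    let ?t = "Ident C E \<oplus> i L \<cdot> v \<cdot> u'"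
    have "(t \<oplus> neg ?t) \<cdot> i L = Zero C L E"
      by (simp add: t(2) d(3) F(4) u'(2) Plus_neg)
    moreover have "t \<oplus> neg ?t \<in> Hom C E E" by (simp add: Hom_def)
    ultimately obtain w where w: "w \<in> Hom C Q E" "w \<cdot> c L = t \<oplus> neg ?t"
      using cokernel_factor[OF c(2) i(1) c(1)] by metis
    note [simp] = HomD[OF w(1)]
    have "t = ?t \<oplus> w \<cdot> c L"
      using diff_eq_iff[of t ?t "w \<cdot> c L"] w(2) by simp
    then have "c L \<cdot> t = c L \<cdot> (?t \<oplus> w \<cdot> c L)" by (rule arg_cong)
    also have "\<dots> = (Ident C Q \<oplus> c L \<cdot> w) \<cdot> c L"
      by (simp add: Comp_eq_extend[OF ci])
    finally have "s \<cdot> c L = (Ident C Q \<oplus> c L \<cdot> w) \<cdot> c L" using s(2) by simp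
    then have s_eq: "s = Ident C Q \<oplus> c L \<cdot> w"
      by (rule epicD[OF cokernel_epic[OF c(2)], of _ _ Q]) (simp_all add: Hom_def)
    show ?thesis
      by (rule stable_eqI[OF s(1) _ _ facI[OF E w(1) c(1)] s_eq]) (simp_all add: Hom_def)
  qed
  have mem: "Ident C L \<in> cls (Ident C L)"
    unfolding stable_class_iff[OF id] using id fac_Zero by (simp add: Plus_neg)
  have D: "Dom C f = L" "Cod C f = L" if "f \<in> cls (Ident C L)" for f
    using that stable_class_iff[OF id] HomD(2,3) by blast+
  have witness: "\<exists>f \<in> cls (Ident C L).
      \<exists>t \<in> Hom C (Cod C (i (Dom C f))) (Cod C (i (Cod C f))).
      \<exists>s \<in> Hom C (Cod C (c (Dom C f))) (Cod C (c (Cod C f))).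
        t \<cdot> i (Dom C f) = i (Cod C f) \<cdot> f \<and> s \<cdot> c (Dom C f) = c (Cod C f) \<cdot> t \<and>
        cls (Ident C Q) = cls s"
    using mem by (intro bexI[of _ "Ident C L"] bexI[of _ "Ident C E"] bexI[of _ "Ident C Q"])
      (simp_all add: Ident_in_Hom)
  have only: "\<sigma> = cls (Ident C Q)"
    if ex: "\<exists>f \<in> cls (Ident C L).
      \<exists>t \<in> Hom C (Cod C (i (Dom C f))) (Cod C (i (Cod C f))).
      \<exists>s \<in> Hom C (Cod C (c (Dom C f))) (Cod C (c (Cod C f))).
        t \<cdot> i (Dom C f) = i (Cod C f) \<cdot> f \<and> s \<cdot> c (Dom C f) = c (Cod C f) \<cdot> t \<and>
        \<sigma> = cls s" for \<sigma>
  proof -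
    obtain f t s where f: "f \<in> cls (Ident C L)"
      and ts: "t \<in> Hom C (Cod C (i (Dom C f))) (Cod C (i (Cod C f)))"
        "s \<in> Hom C (Cod C (c (Dom C f))) (Cod C (c (Cod C f)))"
        "t \<cdot> i (Dom C f) = i (Cod C f) \<cdot> f" "s \<cdot> c (Dom C f) = c (Cod C f) \<cdot> t" "\<sigma> = cls s"
      using ex by (elim bexE conjE)
    show ?thesis using unique[OF f, of t s] ts by (simp add: D[OF f])
  qed
  show ?thesis
    unfolding suspension_arr_def HomD(3)[OF c(1)]
  proof (rule the_equality, goal_cases)
    case 1
    show ?case by (fact witness)
  next
    case (2 \<sigma>)
    then show ?case by (rule only)
  qed
qed

text \<open>
  In a standard triangle \<open>f, g, h\<close> the class of \<open>g\<close> is a weak cokernel of that of \<open>f\<close>: if \<open>u \<cdot> f\<close>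
  factors through \<open>T\<close>, it factors through the preenvelope, and the pushout property makes \<open>u\<close>
  factor through \<open>g\<close>.  So \<open>f\<close> is stably epic once \<open>g\<close> is stably zero.
\<close>

lemma right_triangle_epic:
  assumes data: "suspension_data C T i c" and tri: "right_triangle C T i c \<alpha> \<beta> \<gamma>"
    and zero: "zero_object S (Cod S \<beta>)"
  shows "epic S \<alpha>"
proof -
  interpret Scat: category S by (fact category_stable)
  define A B D where "A = Dom S \<alpha>" and "B = Cod S \<alpha>" and "D = Cod S \<beta>"
  have ab: "\<alpha> \<in> Hom S A B" "\<beta> \<in> Hom S B D"
    using tri unfolding right_triangle_def Let_def
    by (simp_all add: Hom_def A_def B_def D_def)
  obtain f g h x y z where std: "standard_right_triangle C i c f g h"
    and x: "x \<in> Hom S (Dom S \<alpha>) (Dom C f)" "iso_arr S x"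
    and y: "y \<in> Hom S (Cod S \<alpha>) (Cod C f)" "iso_arr S y"
    and z: "z \<in> Hom S (Cod S \<beta>) (Cod C g)"
    and xy: "y \<cdot>\<^bsub>S\<^esub> \<alpha> = cls f \<cdot>\<^bsub>S\<^esub> x" and yz: "z \<cdot>\<^bsub>S\<^esub> \<beta> = cls g \<cdot>\<^bsub>S\<^esub> y"
    using tri unfolding right_triangle_def Let_def by (elim conjE exE bexE)
  define L M N where "L = Dom C f" and "M = Cod C f" and "N = Cod C g"
  obtain j where po: "is_pushout C (i L) f j g"
    using std unfolding standard_right_triangle_def L_def by blast
  then have f: "f \<in> Hom C L M" and g: "g \<in> Hom C M N"
    by (auto simp: is_pushout_def Hom_def L_def M_def N_def)
  obtain E where E: "E \<in> T" "i L \<in> Hom C L E" "preenvelope C T L (i L)"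
    using suspension_typing[OF data] Hom_objects[OF f] by metis
  have xH: "x \<in> Hom S A L" and yH: "y \<in> Hom S B M" and zH: "z \<in> Hom S D N"
    using x y z by (simp_all add: L_def M_def N_def A_def B_def D_def)
  have "fac g"
  proof -
    obtain y' where y': "y' \<in> Hom S M B" "y \<cdot>\<^bsub>S\<^esub> y' = Ident S M"
      using Scat.iso_arrE[OF y(2) yH] by metis
    obtain y0 where y0: "y0 \<in> Hom C M B" "y' = cls y0" using y'(1) by (rule stable_HomE)
    obtain z0 where z0: "z0 \<in> Hom C D N" "z = cls z0" using zH by (rule stable_HomE)
    have BD: "B \<in> Obj C" "D \<in> Obj C" using Scat.Hom_objects[OF ab(2)] by simp_all
    have ZBD: "Zero C B D \<in> Hom C B D" using BD by (simp add: Hom_def)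
    have "\<exists>!b. b \<in> Hom S B D" using zero BD unfolding zero_object_def D_def by simp
    then have b: "\<beta> = cls (Zero C B D)" using ab(2) stable_HomI[OF ZBD] by blast
    have "cls g = cls g \<cdot>\<^bsub>S\<^esub> (y \<cdot>\<^bsub>S\<^esub> y')"
      using y'(2) Scat.Comp_Ident[OF stable_HomI[OF g]] by simp
    also have "\<dots> = (z \<cdot>\<^bsub>S\<^esub> \<beta>) \<cdot>\<^bsub>S\<^esub> y'"
      unfolding yz by (rule Scat.Comp_assoc[OF y'(1) yH stable_HomI[OF g], symmetric])
    also have "\<dots> = cls ((z0 \<cdot> Zero C B D) \<cdot> y0)"
      unfolding b z0(2) y0(2)
      by (simp add: stable_Comp[OF ZBD z0(1)] stable_Comp[OF y0(1) Comp_in_Hom[OF ZBD z0(1)]])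
    also have "\<dots> = cls (Zero C M N)"
      using Hom_simps[OF z0(1)] Hom_simps[OF y0(1)] by simp
    finally show ?thesis using stable_Zero_iff[OF g] by simp
  qed
  have "epic S (cls f)"
  proof (rule stable_epicI[OF f])
    fix W u assume u: "u \<in> Hom C M W" "fac (u \<cdot> f)"
    obtain F t v where F: "F \<in> T" "t \<in> Hom C L F" "v \<in> Hom C F W" "u \<cdot> f = v \<cdot> t"
      using facE[OF u(2) Comp_in_Hom[OF f u(1)]] .
    obtain t' where t': "t' \<in> Hom C E F" "t' \<cdot> i L = t"
      using E(2,3) F(1,2) unfolding preenvelope_def by (auto simp: Hom_def)
    have D: "Cod C (i L) = E" "Cod C f = M" "Cod C j = N"
      using E(2) f po by (auto simp: Hom_def is_pushout_def N_def)
    have "(v \<cdot> t') \<cdot> i L = u \<cdot> f"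
      using Comp_assoc[OF E(2) t'(1) F(3)] t'(2) F(4) by simp
    then obtain z where "z \<in> Hom C N W" "z \<cdot> g = u"
      using po Comp_in_Hom[OF t'(1) F(3)] u(1) unfolding is_pushout_def D by metis
    then show "fac u" using fac_Comp(1)[OF g] \<open>fac g\<close> by blast
  qed
  then show ?thesis
    using Scat.epic_iso_transfer[OF ab(1) stable_HomI[OF f] xH yH xy x(2) y(2)] by blast
qed

lemma right_triangle_of_standard:
  assumes data: "suspension_data C T i c" and std: "standard_right_triangle C i c f g h"
  shows "right_triangle C T i c (cls f) (cls g) (cls h)"
proof -
  interpret Scat: category S by (fact category_stable)
  define L M N where "L = Dom C f" and "M = Cod C f" and "N = Cod C g"
  define Q where "Q = Cod C (c L)"
  have H: "f \<in> Hom C L M" "g \<in> Hom C M N" "h \<in> Hom C N Q"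
    using std
    by (auto simp: standard_right_triangle_def is_pushout_def Hom_def L_def M_def N_def Q_def)
  note D = stable_Dom_Cod[OF H(1)] stable_Dom_Cod[OF H(2)] stable_Dom_Cod[OF H(3)]
  note SH = stable_HomI[OF H(1)] stable_HomI[OF H(2)] stable_HomI[OF H(3)]
  note O = Hom_objects[OF H(1)] Hom_objects[OF H(2)] Hom_objects[OF H(3)]
  note U = Scat.Comp_Ident[OF SH(1)] Scat.Comp_Ident[OF SH(2)] Scat.Comp_Ident[OF SH(3)]
    Scat.Ident_Comp[OF SH(1)] Scat.Ident_Comp[OF SH(2)] Scat.Ident_Comp[OF SH(3)]
  have susp: "suspension_arr C T i c (Ident S L) = Ident S Q"
    using suspension_arr_Ident[OF data O(1)] by (simp add: Q_def)
  have "Ident S L \<in> Hom S L L" "Ident S M \<in> Hom S M M" "Ident S N \<in> Hom S N N"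
    "iso_arr S (Ident S L)" "iso_arr S (Ident S M)" "iso_arr S (Ident S N)"
    using Scat.iso_Ident Scat.Ident_in_Hom O by simp_all
  then have isos: "\<exists>x \<in> Hom S L (Dom C f). \<exists>y \<in> Hom S M (Cod C f). \<exists>z \<in> Hom S N (Cod C g).
      iso_arr S x \<and> iso_arr S y \<and> iso_arr S z \<and>
      y \<cdot>\<^bsub>S\<^esub> cls f = cls f \<cdot>\<^bsub>S\<^esub> x \<and> z \<cdot>\<^bsub>S\<^esub> cls g = cls g \<cdot>\<^bsub>S\<^esub> y \<and>
      suspension_arr C T i c x \<cdot>\<^bsub>S\<^esub> cls h = cls h \<cdot>\<^bsub>S\<^esub> z"
    unfolding L_def[symmetric] M_def[symmetric] N_def[symmetric]
    using U susp by (metis (no_types))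
  show ?thesis
    unfolding right_triangle_def Let_def D
  proof (intro conjI, goal_cases)
    case 5
    show ?case
      by (rule exI[of _ f], rule exI[of _ g], rule exI[of _ h], rule conjI[OF std isos])
  qed (use SH in \<open>simp_all add: Hom_def Q_def\<close>)
qed

lemma left_triangle_monic:
  assumes "loop_data C T p k" "left_triangle C T p k \<gamma> \<beta> \<alpha>" "zero_object S (Dom S \<beta>)"
  shows "monic S \<alpha>"
  using stable_quotient.right_triangle_epic[OF stable_quotient_opposite, of p k \<alpha> \<beta> \<gamma>] assms
  by (simp add: left_triangle_def)

lemma left_triangle_of_standard:
  assumes "loop_data C T p k" "standard_right_triangle (opposite C) p k f g h"
  shows "left_triangle C T p k (cls h) (cls g) (cls f)"
  using stable_quotient.right_triangle_of_standard[OF stable_quotient_opposite, of p k f g h] assms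
  by (simp add: left_triangle_def)

lemma weakly_balanced_if_balanced:
  assumes "balanced S" "suspension_data C T i c" "loop_data C T p k"
  shows "weakly_balanced C T i c p k"
  unfolding weakly_balanced_def Let_def
  using assms right_triangle_epic left_triangle_monic unfolding balanced_def by blast

end

section \<open>Stable isomorphisms and subobjects of torsion objects\<close>

sublocale covariantly_finite_projectives \<subseteq> stable_quotient
  by unfold_locales (fact additive)

context covariantly_finite_projectives
begin

text \<open>
  Adding a preenvelope of the source as a second component changes nothing stably, but turns a stable
  monomorphism into a monomorphism, of which the quotient can then be formed.
\<close>

lemma balanced_if_closed:
  assumes closed: "closed_under_subobjects C (left_perp C T)"
  shows "balanced S"
  unfolding balanced_def
proof (intro allI impI)
  interpret Scat: category S by (fact category_stable)
  fix \<alpha> assume \<alpha>: "monic S \<alpha> \<and> epic S \<alpha>"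
  then have "\<alpha> \<in> Hom S (Dom S \<alpha>) (Cod S \<alpha>)" by (simp add: monic_def Hom_def)
  then obtain M N f where f: "f \<in> Hom C M N" "\<alpha> = cls f" using stable_HomE by metis
  have f_monic: "monic S (cls f)" and f_epic: "epic S (cls f)" using \<alpha> f(2) by simp_all
  obtain E i where i: "i \<in> Hom C M E" "E \<in> T" "preenvelope C T M i"
    using obtain_preenvelope Hom_objects[OF f(1)] by blast
  obtain B i\<^sub>1 i\<^sub>2 p\<^sub>1 p\<^sub>2 where bp: "biproduct C N E B i\<^sub>1 i\<^sub>2 p\<^sub>1 p\<^sub>2"
    using direct_sum_exists Hom_objects[OF f(1)] Hom_objects[OF i(1)]
    unfolding is_direct_sum_def by metis
  note D = biproductD[OF bp]
  note [simp] = Hom_simps[OF f(1)] Hom_simps[OF i(1)]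
    HomD[OF D(1)] HomD[OF D(2)] HomD[OF D(3)] HomD[OF D(4)] D(5-8)
    Comp_eq_extend[OF D(5)] Comp_eq_extend[OF D(6)] Comp_eq_extend[OF D(7)] Comp_eq_extend[OF D(8)]
  have [simp]: "B \<in> Obj C" using Hom_objects[OF D(1)] by blast
  define \<phi> where "\<phi> = i\<^sub>1 \<cdot> f \<oplus> i\<^sub>2 \<cdot> i"
  have \<phi>: "\<phi> \<in> Hom C M B" by (simp add: \<phi>_def Hom_def)
  have p\<phi>: "p\<^sub>1 \<cdot> \<phi> = f" "p\<^sub>2 \<cdot> \<phi> = i" by (simp_all add: \<phi>_def)
  note [simp] = HomD[OF \<phi>]
  \<comment> \<open>The kernel of \<open>\<phi>\<close> lies in the left perpendicular category, and its inclusion into \<open>M\<close> is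
    stably zero because \<open>f\<close> is stably monic.\<close>
  have \<phi>_monic: "monic C \<phi>"
  proof -
    obtain K k where k: "k \<in> Hom C K M" "is_kernel C \<phi> k" "\<phi> \<cdot> k = Zero C K B" "monic C k"
      using obtain_kernel[OF \<phi>] .
    note [simp] = Hom_simps[OF k(1)]
    have fk: "f \<cdot> k = p\<^sub>1 \<cdot> \<phi> \<cdot> k" and ik: "i \<cdot> k = p\<^sub>2 \<cdot> \<phi> \<cdot> k"
      by (simp_all flip: p\<phi>)
    have K: "K \<in> left_perp C T"
      by (rule left_perp_subobject[OF closed i(3,1) k(1,4)]) (simp add: ik k(3))
    have "fac k"
      using stable_monicD[OF f_monic f(1) k(1)] fac_Zero[of K N] by (simp add: fk k(3))
    then obtain F u v where F: "F \<in> T" "u \<in> Hom C K F" "v \<in> Hom C F M" "k = v \<cdot> u"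
      using facE k(1) by blast
    have k0: "k = Zero C K M"
      using left_perpD[OF K F(2,1)] F(4) Hom_simps[OF F(3)] by simp
    show ?thesis
      unfolding monic_iff_zero[OF \<phi>]
    proof (intro allI ballI impI)
      fix W u assume u: "u \<in> Hom C W M" "\<phi> \<cdot> u = Zero C W B"
      obtain y where "y \<in> Hom C W K" "k \<cdot> y = u" using kernel_lift[OF k(2) \<phi> k(1) u] .
      then show "u = Zero C W M" using k0 Hom_simps[of y W K] by simp
    qed
  qed
  obtain Q g where g: "g \<in> Hom C B Q" "is_cokernel C \<phi> g" "g \<cdot> \<phi> = Zero C M Q" "epic C g"
    using obtain_cokernel[OF \<phi>] .
  note [simp] = Hom_simps[OF g(1)]
  note ker = monic_kernel_of_cokernel[OF \<phi>_monic g(2)]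
  \<comment> \<open>Since \<open>g\<close> kills \<open>\<phi>\<close>, which is stably isomorphic to the stable epimorphism \<open>f\<close>, it
    factors through \<open>T\<close>.\<close>
  have "fac g"
  proof -
    have B1: "i\<^sub>1 \<cdot> p\<^sub>1 \<oplus> i\<^sub>2 \<cdot> p\<^sub>2 = Ident C B" by (fact D(9))
    have gi2: "fac ((g \<cdot> i\<^sub>2) \<cdot> x)" if "x \<in> Hom C W E" for x W
      by (rule facI[OF i(2) that Comp_in_Hom[OF D(2) g(1)]])
    have "g \<cdot> (i\<^sub>1 \<cdot> f \<oplus> i\<^sub>2 \<cdot> i) = Zero C M Q" using g(3) by (simp only: \<phi>_def)
    then have "(g \<cdot> i\<^sub>2) \<cdot> i \<oplus> (g \<cdot> i\<^sub>1) \<cdot> f = Zero C M Q"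
      by (simp add: Plus_commute[of "g \<cdot> i\<^sub>1 \<cdot> f"])
    then have "(g \<cdot> i\<^sub>1) \<cdot> f = neg ((g \<cdot> i\<^sub>2) \<cdot> i)"
      by (intro neg_unique[symmetric]) simp_all
    moreover have "fac (neg ((g \<cdot> i\<^sub>2) \<cdot> i))"
      by (rule fac_neg[OF gi2[OF i(1)]]) (simp add: Hom_def)
    ultimately have "fac (g \<cdot> i\<^sub>1)"
      using stable_epicD[OF f_epic f(1) Comp_in_Hom[OF D(1) g(1)]] by simp
    then have "fac ((g \<cdot> i\<^sub>1) \<cdot> p\<^sub>1)" by (rule fac_Comp(2)[OF D(3) Comp_in_Hom[OF D(1) g(1)]])
    have "g = g \<cdot> (i\<^sub>1 \<cdot> p\<^sub>1 \<oplus> i\<^sub>2 \<cdot> p\<^sub>2)" by (simp add: B1)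
    also have "\<dots> = (g \<cdot> i\<^sub>1) \<cdot> p\<^sub>1 \<oplus> (g \<cdot> i\<^sub>2) \<cdot> p\<^sub>2" by simp
    also have "fac \<dots>"
      by (rule fac_Plus[OF \<open>fac ((g \<cdot> i\<^sub>1) \<cdot> p\<^sub>1)\<close> _ gi2[OF D(4)], of B Q]) (simp_all add: Hom_def)
    finally show ?thesis .
  qed
  then obtain F u v where F: "F \<in> T" "u \<in> Hom C B F" "v \<in> Hom C F Q" "g = v \<cdot> u"
    using facE g(1) by blast
  obtain w where w: "w \<in> Hom C F B" "g \<cdot> w = v"
    using projective_lift[OF T_projective[OF F(1)] g(4,1) F(3)] .
  note [simp] = HomD[OF F(2)] HomD[OF F(3)] HomD[OF w(1)]
  let ?x = "Ident C B \<oplus> neg (w \<cdot> u)"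
  have "g \<cdot> ?x = Zero C B Q"
    by (simp add: Comp_eq_extend[OF w(2)] F(4)[symmetric] Plus_neg)
  moreover have "?x \<in> Hom C B B" by (simp add: Hom_def)
  ultimately obtain r where r: "r \<in> Hom C B M" "\<phi> \<cdot> r = ?x"
    using kernel_lift[OF ker g(1) \<phi>] by metis
  note [simp] = HomD[OF r(1)]
  define s where "s = r \<cdot> i\<^sub>1"
  have s: "s \<in> Hom C N M" by (simp add: s_def Hom_def)
  have "f \<cdot> s = p\<^sub>1 \<cdot> (\<phi> \<cdot> r) \<cdot> i\<^sub>1" by (simp add: s_def p\<phi>(1)[symmetric])
  also have "\<dots> = Ident C N \<oplus> neg ((p\<^sub>1 \<cdot> w) \<cdot> (u \<cdot> i\<^sub>1))" by (simp only: r(2)) simp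
  finally have fs: "f \<cdot> s = Ident C N \<oplus> neg ((p\<^sub>1 \<cdot> w) \<cdot> (u \<cdot> i\<^sub>1))" .
  have "fac ((p\<^sub>1 \<cdot> w) \<cdot> (u \<cdot> i\<^sub>1))"
    by (rule facI[OF F(1), of _ N _ N]) (simp_all add: Hom_def)
  then have "fac (neg ((p\<^sub>1 \<cdot> w) \<cdot> (u \<cdot> i\<^sub>1)))"
    by (rule fac_neg) (simp add: Hom_def)
  then have "cls (f \<cdot> s) = cls (Ident C N)"
    by (rule stable_eqI[OF Comp_in_Hom[OF s f(1)] Ident_in_Hom _ _ fs, rotated 2]) (simp_all add: Hom_def)
  then have fs1: "cls f \<cdot>\<^bsub>S\<^esub> cls s = Ident S N" using stable_Comp[OF s f(1)] by simp
  have F1: "cls f \<in> Hom S M N" and S1: "cls s \<in> Hom S N M"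
    using stable_HomI f(1) s by blast+
  have "cls f \<cdot>\<^bsub>S\<^esub> (cls s \<cdot>\<^bsub>S\<^esub> cls f) = (cls f \<cdot>\<^bsub>S\<^esub> cls s) \<cdot>\<^bsub>S\<^esub> cls f"
    by (rule Scat.Comp_assoc[OF F1 S1 F1, symmetric])
  also have "\<dots> = cls f \<cdot>\<^bsub>S\<^esub> Ident S M"
    unfolding fs1 using Scat.Comp_Ident[OF F1] Scat.Ident_Comp[OF F1] by (simp del: stable_Ident)
  finally have "cls s \<cdot>\<^bsub>S\<^esub> cls f = Ident S M"
    by (rule Scat.monicD[OF f_monic, of _ _ M])
      (use F1 S1 Scat.Comp_in_Hom Scat.Ident_in_Hom[of M] in
        \<open>simp_all add: stable_Dom_Cod[OF f(1)] del: stable_Ident\<close>)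
  then show "iso_arr S \<alpha>"
    unfolding iso_arr_def f(2) stable_Dom_Cod[OF f(1)] using fs1 F1 S1
    by (auto simp: Hom_def simp del: stable_Ident)
qed

text \<open>
  Any preenvelope \<open>i : Y \<rightarrow> E\<close> becomes such a one after removing a superfluous summand of \<open>E\<close>.  The
  torsion-free part of the cokernel of \<open>i\<close> is projective, so the projection of \<open>E\<close> onto it splits;
  the kernel \<open>F\<close> of this projection is a summand of \<open>E\<close> and contains the image of \<open>i\<close>.  The last
  conclusion says that the cokernel of \<open>f\<close> is perpendicular to \<open>T\<close>.
\<close>

lemma obtain_preenvelope_with_torsion_cokernel:
  assumes "Y \<in> Obj C"
  obtains F f where "F \<in> T" "f \<in> Hom C Y F" "preenvelope C T Y f"
    "\<And>X x. X \<in> T \<Longrightarrow> x \<in> Hom C F X \<Longrightarrow> x \<cdot> f = Zero C Y X \<Longrightarrow> x = Zero C F X"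
proof -
  obtain E i where i: "i \<in> Hom C Y E" "E \<in> T" "preenvelope C T Y i"
    using obtain_preenvelope[OF assms] .
  obtain Q c where c: "c \<in> Hom C E Q" "is_cokernel C i c" "c \<cdot> i = Zero C Y Q" "epic C c"
    using obtain_cokernel[OF i(1)] .
  obtain G q where q: "q \<in> Hom C Q G" "G \<in> T" "preenvelope C T Q q"
    using obtain_preenvelope Hom_objects[OF c(1)] by metis
  obtain I e m where me: "e \<in> Hom C E I" "epic C e" "m \<in> Hom C I G" "monic C m" "m \<cdot> e = q \<cdot> c"
    using image_factorization[OF Comp_in_Hom[OF c(1) q(1)]] .
  obtain s where s: "s \<in> Hom C I E" "e \<cdot> s = Ident C I"
    using projective_section[OF monic_into_T_projective[OF me(4,3) q(2)] me(2,1)] .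
  obtain F k where k: "k \<in> Hom C F E" "is_kernel C e k" "e \<cdot> k = Zero C F I"
    using obtain_kernel[OF me(1)] by metis
  obtain r where bp: "biproduct C F I E k s r e"
    using split_kernel_biproduct[OF me(1) s k(2,1)] .
  have F: "F \<in> T" by (rule T_summand[OF bp i(2)])
  have r: "r \<in> Hom C E F" "r \<cdot> k = Ident C F" using bp by (simp_all add: biproduct_def)
  note [simp] = Hom_simps[OF i(1)] Hom_simps[OF c(1)] Hom_simps[OF q(1)] HomD[OF me(1)]
    HomD[OF me(3)] Hom_simps[OF k(1)] HomD[OF r(1)] r(2) Hom_objects[OF me(3)]
  have "m \<cdot> e \<cdot> i = (m \<cdot> e) \<cdot> i" by simp
  also have "\<dots> = Zero C Y G" by (subst me(5)) (simp add: c(3))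
  finally have "e \<cdot> i = Zero C Y I"
    using monic_iff_zero[OF me(3)] me(4) Comp_in_Hom[OF i(1) me(1)] by blast
  then obtain f where f: "f \<in> Hom C Y F" "k \<cdot> f = i"
    using kernel_lift[OF k(2) me(1) k(1) i(1)] by metis
  note [simp] = HomD[OF f(1)]
  have pre: "preenvelope C T Y f"
    unfolding preenvelope_def
  proof (intro conjI ballI)
    fix X h assume X: "X \<in> T" "h \<in> Hom C Y X"
    obtain h' where h': "h' \<in> Hom C E X" "h' \<cdot> i = h"
      using preenvelope_extend[OF i(3,1) X] .
    have "(h' \<cdot> k) \<cdot> f = h" using HomD[OF h'(1)] by (simp add: f(2) h'(2))
    then show "\<exists>g \<in> Hom C (Cod C f) X. g \<cdot> f = h"
      using Comp_in_Hom[OF k(1) h'(1)] by auto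
  qed (use F in simp_all)
  show thesis
  proof (rule that[OF F f(1) pre])
    fix X x assume X: "X \<in> T" and x: "x \<in> Hom C F X" "x \<cdot> f = Zero C Y X"
    note [simp] = Hom_simps[OF x(1)]
    have "r \<cdot> i = f" by (simp add: f(2)[symmetric] Comp_eq_extend[OF r(2)])
    then have "(x \<cdot> r) \<cdot> i = Zero C Y X" by (simp add: x(2))
    then obtain y where y: "y \<in> Hom C Q X" "y \<cdot> c = x \<cdot> r"
      using cokernel_factor[OF c(2) i(1) c(1) Comp_in_Hom[OF r(1) x(1)]] by metis
    obtain z where z: "z \<in> Hom C G X" "z \<cdot> q = y"
      using preenvelope_extend[OF q(3,1) X y(1)] .
    note [simp] = HomD[OF y(1)] HomD[OF z(1)]
    have "x = (x \<cdot> r) \<cdot> k" by simp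
    also have "\<dots> = (y \<cdot> c) \<cdot> k" by (simp only: y(2))
    also have "\<dots> = z \<cdot> (q \<cdot> c) \<cdot> k" by (simp add: z(2)[symmetric])
    also have "\<dots> = Zero C F X" by (simp only: me(5)[symmetric]) (simp add: k(3))
    finally show "x = Zero C F X" .
  qed
qed

text \<open>
  The epimorphism onto the cokernel of \<open>m\<close> from the pushout of \<open>m\<close> along a preenvelope as above.
\<close>

lemma obtain_torsion_epimorphism:
  assumes X: "X \<in> left_perp C T" and m: "m \<in> Hom C Y X" "monic C m"
  obtains N Z F \<pi> k where "\<pi> \<in> Hom C N Z" "epic C \<pi>" "k \<in> Hom C F N" "is_kernel C \<pi> k" "F \<in> T"
    "N \<in> left_perp C T" "Z \<in> left_perp C T" "k = Zero C F N \<longrightarrow> Y \<in> left_perp C T"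
proof -
  obtain F f where f: "F \<in> T" "f \<in> Hom C Y F" "preenvelope C T Y f"
    and f_epic: "\<And>X x. X \<in> T \<Longrightarrow> x \<in> Hom C F X \<Longrightarrow> x \<cdot> f = Zero C Y X \<Longrightarrow> x = Zero C F X"
    using obtain_preenvelope_with_torsion_cokernel Hom_objects[OF m(1)] by metis
  obtain Z p where p: "p \<in> Hom C X Z" "is_cokernel C m p" "p \<cdot> m = Zero C Y Z" "epic C p"
    using obtain_cokernel[OF m(1)] .
  obtain B i\<^sub>1 i\<^sub>2 p\<^sub>1 p\<^sub>2 where bp: "biproduct C X F B i\<^sub>1 i\<^sub>2 p\<^sub>1 p\<^sub>2"
    using direct_sum_exists Hom_objects[OF m(1)] Hom_objects[OF f(2)]
    unfolding is_direct_sum_def by metis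
  note D = biproductD[OF bp]
  note [simp] = Hom_simps[OF m(1)] Hom_simps[OF f(2)] Hom_simps[OF p(1)]
    HomD[OF D(1)] HomD[OF D(2)] HomD[OF D(3)] HomD[OF D(4)] D(5-8)
    Comp_eq_extend[OF D(5)] Comp_eq_extend[OF D(6)] Comp_eq_extend[OF D(7)] Comp_eq_extend[OF D(8)]
  have [simp]: "B \<in> Obj C" using Hom_objects[OF D(1)] by blast
  define d where "d = i\<^sub>1 \<cdot> m \<oplus> i\<^sub>2 \<cdot> neg f"
  have d: "d \<in> Hom C Y B" by (simp add: d_def Hom_def)
  have d_monic: "monic C d"
    unfolding d_def
    by (rule monic_into_biproduct[OF bp m(1), of "neg f"])
      (use monic_iff_zero[OF m(1)] m(2) in \<open>auto simp: Hom_def\<close>)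
  have pd: "p\<^sub>1 \<cdot> d = m" "p\<^sub>2 \<cdot> d = neg f" by (simp_all add: d_def del: Comp_neg)
  obtain N q where q: "q \<in> Hom C B N" "is_cokernel C d q" "q \<cdot> d = Zero C Y N" "epic C q"
    using obtain_cokernel[OF d] .
  note ker = monic_kernel_of_cokernel[OF d_monic q(2)]
  note [simp] = HomD[OF d] Hom_simps[OF q(1)]
  \<comment> \<open>\<open>N\<close> is the pushout of \<open>m\<close> and \<open>f\<close>, with structure maps \<open>j\<close> and \<open>k\<close>.\<close>
  define j k where "j = q \<cdot> i\<^sub>1" and "k = q \<cdot> i\<^sub>2"
  have j: "j \<in> Hom C X N" and k: "k \<in> Hom C F N" by (simp_all add: j_def k_def Hom_def)
  note [simp] = HomD[OF j] HomD[OF k]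
  have square: "j \<cdot> m = k \<cdot> f"
  proof -
    have "j \<cdot> m \<oplus> neg (k \<cdot> f) = Zero C Y N"
      using q(3) by (simp add: d_def j_def k_def)
    then show ?thesis by (subst eq_iff_diff) simp_all
  qed
  have split: "x \<cdot> q = (x \<cdot> j) \<cdot> p\<^sub>1 \<oplus> (x \<cdot> k) \<cdot> p\<^sub>2" if "x \<in> Hom C N W" for x W
  proof -
    have "x \<cdot> q = x \<cdot> q \<cdot> (i\<^sub>1 \<cdot> p\<^sub>1 \<oplus> i\<^sub>2 \<cdot> p\<^sub>2)" unfolding D(9) using HomD[OF that] by simp
    then show ?thesis using HomD[OF that] by (simp add: j_def k_def)
  qed
  have vanish: "x = Zero C N W"
    if x: "x \<in> Hom C N W" "x \<cdot> j = Zero C X W" "x \<cdot> k = Zero C F W" for x W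
  proof -
    note [simp] = Hom_simps[OF x(1)]
    have "x \<cdot> q = Zero C B W" using split[OF x(1)] x(2,3) by simp
    then show ?thesis using epic_iff_zero[OF q(1)] q(4) x(1) by blast
  qed
  have "(p \<cdot> p\<^sub>1) \<cdot> d = Zero C Y Z" by (simp add: pd(1) p(3))
  then obtain \<pi> where \<pi>: "\<pi> \<in> Hom C N Z" "\<pi> \<cdot> q = p \<cdot> p\<^sub>1"
    using cokernel_factor[OF q(2) d q(1) Comp_in_Hom[OF D(3) p(1)]] by metis
  note [simp] = HomD[OF \<pi>(1)]
  have \<pi>j: "\<pi> \<cdot> j = p" and \<pi>k: "\<pi> \<cdot> k = Zero C F Z"
    by (simp_all add: j_def k_def Comp_eq_extend[OF \<pi>(2)])
  have \<pi>_epic: "epic C \<pi>"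
    unfolding epic_iff_zero[OF \<pi>(1)]
  proof (intro allI ballI impI)
    fix W u assume u: "u \<in> Hom C Z W" "u \<cdot> \<pi> = Zero C N W"
    note [simp] = Hom_simps[OF u(1)]
    have "u \<cdot> p = (u \<cdot> \<pi>) \<cdot> j" by (simp add: \<pi>j)
    also have "\<dots> = Zero C X W" by (simp only: u(2)) simp
    finally show "u = Zero C Z W" using epic_iff_zero[OF p(1)] p(4) u(1) by blast
  qed
  have k_monic: "monic C k"
    unfolding monic_iff_zero[OF k]
  proof (intro allI ballI impI)
    fix W y assume y: "y \<in> Hom C W F" "k \<cdot> y = Zero C W N"
    note [simp] = Hom_simps[OF y(1)]
    have "i\<^sub>2 \<cdot> y \<in> Hom C W B" "q \<cdot> i\<^sub>2 \<cdot> y = Zero C W N"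
      using y(2) by (simp_all add: k_def Hom_def)
    then obtain w where w: "w \<in> Hom C W Y" "d \<cdot> w = i\<^sub>2 \<cdot> y"
      using kernel_lift[OF ker q(1) d] by metis
    note [simp] = Hom_simps[OF w(1)]
    have "m \<cdot> w = p\<^sub>1 \<cdot> d \<cdot> w" by (simp add: pd(1)[symmetric])
    also have "\<dots> = Zero C W X" by (simp add: w(2))
    finally have w0: "w = Zero C W Y" using monic_iff_zero[OF m(1)] m(2) w(1) by blast
    have "y = p\<^sub>2 \<cdot> i\<^sub>2 \<cdot> y" by simp
    also have "\<dots> = Zero C W F" unfolding w(2)[symmetric] w0 by simp
    finally show "y = Zero C W F" .
  qed
  have "is_cokernel C k \<pi>"
  proof (rule is_cokernelI[OF \<pi>_epic \<pi>(1) k \<pi>k])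
    fix W x assume x: "x \<in> Hom C N W" "x \<cdot> k = Zero C F W"
    note [simp] = Hom_simps[OF x(1)]
    have "(x \<cdot> j) \<cdot> m = (x \<cdot> k) \<cdot> f" by (simp add: square)
    also have "\<dots> = Zero C Y W" by (simp only: x(2)) simp
    finally obtain y where y: "y \<in> Hom C Z W" "y \<cdot> p = x \<cdot> j"
      using cokernel_factor[OF p(2) m(1) p(1) Comp_in_Hom[OF j x(1)]] by metis
    note [simp] = HomD[OF y(1)]
    have "x \<cdot> q = (x \<cdot> j) \<cdot> p\<^sub>1" using split[OF x(1)] x(2) by simp
    also have "\<dots> = (y \<cdot> \<pi>) \<cdot> q" by (simp only: y(2)[symmetric]) (simp add: \<pi>(2))
    finally have "x = y \<cdot> \<pi>"
      by (rule epicD[OF q(4), of _ _ W]) (simp_all add: Hom_def)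
    then show "\<exists>y \<in> Hom C Z W. y \<cdot> \<pi> = x" using y(1) by blast
  qed
  then have k_kernel: "is_kernel C \<pi> k" by (rule monic_kernel_of_cokernel[OF k_monic])
  have N: "N \<in> left_perp C T"
  proof (rule left_perpI)
    fix E x assume E: "E \<in> T" and x: "x \<in> Hom C N E"
    note [simp] = Hom_simps[OF x(1)]
    have xj: "x \<cdot> j = Zero C X E" by (rule left_perpD[OF X Comp_in_Hom[OF j x] E])
    have "(x \<cdot> k) \<cdot> f = (x \<cdot> j) \<cdot> m" by (simp add: square)
    also have "\<dots> = Zero C Y E" by (simp only: xj) simp
    finally have "x \<cdot> k = Zero C F E" by (rule f_epic[OF E Comp_in_Hom[OF k x]])
    then show "x = Zero C N E" by (rule vanish[OF x xj])
  qed (use T_Obj in simp_all)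
  have Z: "Z \<in> left_perp C T" by (rule left_perp_quotient[OF p(4,1) X T_Obj])
  have Y: "k = Zero C F N \<longrightarrow> Y \<in> left_perp C T"
  proof
    assume k0: "k = Zero C F N"
    have "k \<cdot> Ident C F = Zero C F N" using k0 by simp
    then have id0: "Ident C F = Zero C F F"
      using monic_iff_zero[OF k] k_monic Ident_in_Hom[of F] by simp
    have f0: "f = Zero C Y F" using id0 Ident_Comp[OF f(2)] by simp
    show "Y \<in> left_perp C T"
    proof (rule left_perpI)
      fix E x assume E: "E \<in> T" and x: "x \<in> Hom C Y E"
      obtain y where y: "y \<in> Hom C F E" "y \<cdot> f = x" using preenvelope_extend[OF f(3,2) E x] .
      then show "x = Zero C Y E" using Hom_simps[OF y(1)] f0 by simp
    qed (use T_Obj in simp_all)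
  qed
  show thesis by (rule that[OF \<pi>(1) \<pi>_epic k k_kernel f(1) N Z Y])
qed

lemma fac_from_left_perp:
  assumes "M \<in> left_perp C T" "f \<in> Hom C M N" "fac f"
  shows "f = Zero C M N"
proof -
  obtain E u v where E: "E \<in> T" "u \<in> Hom C M E" "v \<in> Hom C E N" "f = v \<cdot> u"
    using facE[OF assms(3,2)] .
  then show ?thesis using left_perpD[OF assms(1) E(2,1)] Hom_simps[OF E(2)] Hom_simps[OF E(3)] by simp
qed

text \<open>
  If \<open>\<pi> \<cdot> u\<close> factors through \<open>T\<close>, then by projectivity it lifts along \<open>\<pi>\<close>, and \<open>u\<close> differs from
  the lift by an arrow through the kernel \<open>F\<close>; this gives the monomorphism.  On arrows out of \<open>N\<close>
  the passage to classes is injective, which gives the other two assertions.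
\<close>

lemma torsion_epimorphism_stable:
  assumes \<pi>: "\<pi> \<in> Hom C N Z" "epic C \<pi>" and k: "k \<in> Hom C F N" "is_kernel C \<pi> k" and F: "F \<in> T"
    and N: "N \<in> left_perp C T" and Z: "Z \<in> left_perp C T"
  shows "monic S (cls \<pi>)" "epic S (cls \<pi>)" "iso_arr S (cls \<pi>) \<Longrightarrow> k = Zero C F N"
proof -
  interpret Scat: category S by (fact category_stable)
  note [simp] = Hom_simps[OF \<pi>(1)] Hom_simps[OF k(1)]
  show "monic S (cls \<pi>)"
  proof (rule stable_monicI[OF \<pi>(1)])
    fix W u assume u: "u \<in> Hom C W N" "fac (\<pi> \<cdot> u)"
    obtain E a b where E: "E \<in> T" "a \<in> Hom C W E" "b \<in> Hom C E Z" "\<pi> \<cdot> u = b \<cdot> a"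
      using facE[OF u(2) Comp_in_Hom[OF u(1) \<pi>(1)]] .
    obtain b' where b': "b' \<in> Hom C E N" "\<pi> \<cdot> b' = b"
      using projective_lift[OF T_projective[OF E(1)] \<pi>(2,1) E(3)] .
    note [simp] = Hom_simps[OF u(1)] HomD[OF E(2)] HomD[OF b'(1)]
    let ?w = "u \<oplus> neg (b' \<cdot> a)"
    have "\<pi> \<cdot> ?w = Zero C W Z"
      by (simp add: Comp_eq_extend[OF b'(2)] E(4)[symmetric] Plus_neg)
    moreover have "?w \<in> Hom C W N" by (simp add: Hom_def)
    ultimately obtain y where y: "y \<in> Hom C W F" "k \<cdot> y = ?w"
      using kernel_lift[OF k(2) \<pi>(1) k(1)] by metis
    have u_eq: "u = b' \<cdot> a \<oplus> k \<cdot> y"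
      using diff_eq_iff[of u "b' \<cdot> a" "k \<cdot> y"] y HomD[OF y(1)] by simp
    show "fac u"
      unfolding u_eq
      by (rule fac_Plus[OF facI[OF E(1,2) b'(1)] Comp_in_Hom[OF E(2) b'(1)]
            facI[OF F y(1) k(1)] Comp_in_Hom[OF y(1) k(1)]])
  qed
  show "epic S (cls \<pi>)"
  proof (rule stable_epicI[OF \<pi>(1)])
    fix W u assume u: "u \<in> Hom C Z W" "fac (u \<cdot> \<pi>)"
    have "u \<cdot> \<pi> = Zero C N W" by (rule fac_from_left_perp[OF N Comp_in_Hom[OF \<pi>(1) u(1)] u(2)])
    then have "u = Zero C Z W" using epic_iff_zero[OF \<pi>(1)] \<pi>(2) u(1) by blast
    then show "fac u" using fac_Zero Hom_objects[OF u(1)] by simp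
  qed
  assume "iso_arr S (cls \<pi>)"
  then obtain a where a: "a \<in> Hom S Z N" "a \<cdot>\<^bsub>S\<^esub> cls \<pi> = Ident S N"
    using Scat.iso_arrE[OF _ stable_HomI[OF \<pi>(1)]] by metis
  obtain s where s: "s \<in> Hom C Z N" "a = cls s" using a(1) by (rule stable_HomE)
  note [simp] = HomD[OF s(1)]
  have s\<pi>: "s \<cdot> \<pi> \<in> Hom C N N" "Ident C N \<in> Hom C N N" by (simp_all add: Hom_def)
  have "cls (s \<cdot> \<pi>) = cls (Ident C N)"
    using a(2) stable_Comp[OF \<pi>(1) s(1)] s(2) by simp
  then obtain d where d: "d \<in> Hom C N N" "fac d" "s \<cdot> \<pi> = Ident C N \<oplus> d"
    using stable_eqE[OF _ s\<pi>] by metis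
  have "s \<cdot> \<pi> = Ident C N" using d(3) fac_from_left_perp[OF N d(1,2)] by simp
  then have "k = (s \<cdot> \<pi>) \<cdot> k" by simp
  also have "\<dots> = Zero C F N" by (simp add: kernelD[OF k(2) \<pi>(1) k(1)])
  finally show "k = Zero C F N" .
qed

text \<open>
  The preenvelope \<open>N \<rightarrow> E\<close> is zero, so its pushout along the epimorphism \<open>\<pi>\<close> is \<open>E\<close> with the zero
  arrow from \<open>Z\<close>.
\<close>

lemma right_triangle_on_left_perp:
  assumes data: "suspension_data C T i c" and \<pi>: "\<pi> \<in> Hom C N Z" "epic C \<pi>" and N: "N \<in> left_perp C T"
  shows "\<exists>\<beta> \<gamma>. zero_object S (Cod S \<beta>) \<and> right_triangle C T i c (cls \<pi>) \<beta> \<gamma>"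
proof -
  note [simp] = Hom_simps[OF \<pi>(1)]
  obtain E Q where i: "i N \<in> Hom C N E" and E: "E \<in> T" and c: "c N \<in> Hom C E Q"
    using suspension_typing[OF data] Hom_objects(1)[OF \<pi>(1)] by metis
  have i0: "i N = Zero C N E" by (rule left_perpD[OF N i E])
  note [simp] = Hom_simps[OF c]
  have Z: "Zero C Z E \<in> Hom C Z E" by (simp add: Hom_def)
  have "is_pushout C (i N) \<pi> (Ident C E) (Zero C Z E)"
    unfolding is_pushout_def
  proof (intro conjI allI ballI impI)
    fix W x y assume x: "x \<in> Hom C (Cod C (i N)) W" and y: "y \<in> Hom C (Cod C \<pi>) W"
      and eq: "x \<cdot> i N = y \<cdot> \<pi>"
    have x: "x \<in> Hom C E W" and y: "y \<in> Hom C Z W" using x y by (simp_all add: i0)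
    note [simp] = Hom_simps[OF x]
    have "y \<cdot> \<pi> = Zero C N W" using eq by (simp add: i0)
    then have "y = Zero C Z W" using epic_iff_zero[OF \<pi>(1)] \<pi>(2) y by blast
    then show "\<exists>!z. z \<in> Hom C (Cod C (Ident C E)) W \<and> z \<cdot> Ident C E = x \<and> z \<cdot> Zero C Z E = y"
      using x Comp_Ident by (intro ex1I[of _ x]) auto
  qed (simp_all add: i0)
  then have "standard_right_triangle C i c \<pi> (Zero C Z E) (c N)"
    unfolding standard_right_triangle_def
    by (intro exI[of _ "Ident C E"]) (simp add: Hom_def)
  then have "right_triangle C T i c (cls \<pi>) (cls (Zero C Z E)) (cls (c N))"
    by (rule right_triangle_of_standard[OF data])
  moreover have "zero_object S (Cod S (cls (Zero C Z E)))"
    using zero_object_stable[OF E] stable_Dom_Cod[OF Z] by simp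
  ultimately show ?thesis by blast
qed

text \<open>
  The precover \<open>E \<rightarrow> Z\<close> lifts along \<open>\<pi>\<close> by projectivity of \<open>E\<close>, so the pullback of \<open>\<pi>\<close> is the
  direct sum of its kernel \<open>F\<close> and \<open>E\<close>, an object of \<open>T\<close>.
\<close>

lemma left_triangle_on_epimorphism:
  assumes data: "loop_data C T p l" and \<pi>: "\<pi> \<in> Hom C N Z" "epic C \<pi>"
    and k: "k \<in> Hom C F N" "is_kernel C \<pi> k" and F: "F \<in> T"
  shows "\<exists>\<beta> \<gamma>. zero_object S (Dom S \<beta>) \<and> left_triangle C T p l \<gamma> \<beta> (cls \<pi>)"
proof -
  note [simp] = Hom_simps[OF \<pi>(1)] Hom_simps[OF k(1)]
  obtain E Q where p: "p Z \<in> Hom C E Z" and E: "E \<in> T" and l: "l Z \<in> Hom C Q E"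
    and lk: "is_kernel C (p Z) (l Z)"
    using stable_quotient.suspension_typing[OF stable_quotient_opposite, of p l Z thesis] data that
    by simp
  note [simp] = Hom_simps[OF p] Hom_simps[OF l]
  have pl: "p Z \<cdot> l Z = Zero C Q Z" by (rule kernelD[OF lk p l])
  have \<pi>k [simp]: "\<pi> \<cdot> k = Zero C F Z" by (rule kernelD[OF k(2) \<pi>(1) k(1)])
  obtain s where s: "s \<in> Hom C E N" "\<pi> \<cdot> s = p Z"
    using projective_lift[OF T_projective[OF E] \<pi>(2,1) p] .
  obtain L i\<^sub>1 i\<^sub>2 p\<^sub>1 p\<^sub>2 where L: "L \<in> T" and bp: "biproduct C F E L i\<^sub>1 i\<^sub>2 p\<^sub>1 p\<^sub>2"
    using additive F E unfolding additive_subcategory_def is_direct_sum_def by metis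
  note D = biproductD[OF bp]
  note [simp] = HomD[OF s(1)] s(2) Comp_eq_extend[OF s(2)] Comp_eq_extend[OF \<pi>k]
    HomD[OF D(1)] HomD[OF D(2)] HomD[OF D(3)] HomD[OF D(4)] D(5-8)
    Comp_eq_extend[OF D(5)] Comp_eq_extend[OF D(6)] Comp_eq_extend[OF D(7)] Comp_eq_extend[OF D(8)]
  have [simp]: "L \<in> Obj C" using L T_Obj by blast
  define g where "g = k \<cdot> p\<^sub>1 \<oplus> s \<cdot> p\<^sub>2"
  have g: "g \<in> Hom C L N" by (simp add: g_def Hom_def)
  note [simp] = HomD[OF g]
  have pullback: "\<exists>!z. z \<in> Hom C W L \<and> p\<^sub>2 \<cdot> z = x \<and> g \<cdot> z = y"
    if x: "x \<in> Hom C W E" and y: "y \<in> Hom C W N" and eq: "p Z \<cdot> x = \<pi> \<cdot> y" for W x y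
  proof -
    note [simp] = Hom_simps[OF x] HomD[OF y]
    have "\<pi> \<cdot> (y \<oplus> neg (s \<cdot> x)) = Zero C W Z" by (simp add: eq Plus_neg)
    moreover have "y \<oplus> neg (s \<cdot> x) \<in> Hom C W N" by (simp add: Hom_def)
    ultimately obtain w where w: "w \<in> Hom C W F" "k \<cdot> w = y \<oplus> neg (s \<cdot> x)"
      using kernel_lift[OF k(2) \<pi>(1) k(1)] by metis
    note [simp] = HomD[OF w(1)]
    have y_eq: "y = s \<cdot> x \<oplus> k \<cdot> w" using diff_eq_iff[of y "s \<cdot> x" "k \<cdot> w"] w(2) by simp
    show ?thesis
    proof (intro ex1I[of _ "i\<^sub>1 \<cdot> w \<oplus> i\<^sub>2 \<cdot> x"] conjI)
      show "i\<^sub>1 \<cdot> w \<oplus> i\<^sub>2 \<cdot> x \<in> Hom C W L" by (simp add: Hom_def)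
      show "p\<^sub>2 \<cdot> (i\<^sub>1 \<cdot> w \<oplus> i\<^sub>2 \<cdot> x) = x" by simp
      show "g \<cdot> (i\<^sub>1 \<cdot> w \<oplus> i\<^sub>2 \<cdot> x) = y"
        by (simp add: g_def y_eq Plus_commute[of "k \<cdot> w"])
      fix z assume z: "z \<in> Hom C W L \<and> p\<^sub>2 \<cdot> z = x \<and> g \<cdot> z = y"
      note [simp] = HomD[OF conjunct1[OF z]]
      have gz: "g \<cdot> z = y" and pz: "p\<^sub>2 \<cdot> z = x" using z by auto
      have "s \<cdot> x \<oplus> k \<cdot> p\<^sub>1 \<cdot> z = s \<cdot> x \<oplus> k \<cdot> w"
        using gz unfolding g_def y_eq by (simp add: pz Plus_commute[of "k \<cdot> p\<^sub>1 \<cdot> z"])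
      then have "k \<cdot> p\<^sub>1 \<cdot> z = k \<cdot> w" by (rule Plus_cancel) simp_all
      then have p1z: "p\<^sub>1 \<cdot> z = w"
        by (rule monicD[OF kernel_monic[OF k(2)], of _ _ W]) (simp_all add: Hom_def)
      have "z = (i\<^sub>1 \<cdot> p\<^sub>1 \<oplus> i\<^sub>2 \<cdot> p\<^sub>2) \<cdot> z" unfolding D(9) by simp
      also have "\<dots> = i\<^sub>1 \<cdot> w \<oplus> i\<^sub>2 \<cdot> x" by (simp add: p1z pz)
      finally show "z = i\<^sub>1 \<cdot> w \<oplus> i\<^sub>2 \<cdot> x" .
    qed
  qed
  have po: "is_pushout (opposite C) (p Z) \<pi> p\<^sub>2 g"
    unfolding is_pushout_def
    by (simp add: pullback) (simp add: g_def)
  have "\<exists>!h. h \<in> Hom C Q L \<and> p\<^sub>2 \<cdot> h = l Z \<and> g \<cdot> h = Zero C Q N"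
    by (rule pullback) (simp_all add: Hom_def pl)
  then obtain h where h: "h \<in> Hom C Q L" "p\<^sub>2 \<cdot> h = l Z" "g \<cdot> h = Zero C Q N" by blast
  have "standard_right_triangle (opposite C) p l \<pi> g h"
    unfolding standard_right_triangle_def using po h by (intro exI[of _ "p\<^sub>2"]) simp
  then have "left_triangle C T p l (cls h) (cls g) (cls \<pi>)"
    by (rule left_triangle_of_standard[OF data])
  moreover have "zero_object S (Dom S (cls g))"
    using zero_object_stable[OF L] stable_Dom_Cod[OF g] by simp
  ultimately show ?thesis by blast
qed

text \<open>
  Both balancedness conditions apply to the epimorphisms between perpendicular objects with kernel in
  \<open>T\<close>, and these suffice to detect closure under subobjects.
\<close>

lemma closed_if_torsion_epimorphisms_iso:
  assumes "\<And>N Z F \<pi> k. \<pi> \<in> Hom C N Z \<Longrightarrow> epic C \<pi> \<Longrightarrow> k \<in> Hom C F N \<Longrightarrow> is_kernel C \<pi> k \<Longrightarrow> F \<in> T \<Longrightarrow>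
    N \<in> left_perp C T \<Longrightarrow> Z \<in> left_perp C T \<Longrightarrow> iso_arr S (cls \<pi>)"
  shows "closed_under_subobjects C (left_perp C T)"
  unfolding closed_under_subobjects_def subobject_def
proof (intro ballI allI impI, elim bexE)
  fix X Y m assume X: "X \<in> left_perp C T" and m: "m \<in> Hom C Y X" "monic C m"
  obtain N Z F \<pi> k where t: "\<pi> \<in> Hom C N Z" "epic C \<pi>" "k \<in> Hom C F N" "is_kernel C \<pi> k" "F \<in> T"
    "N \<in> left_perp C T" "Z \<in> left_perp C T" and Y: "k = Zero C F N \<longrightarrow> Y \<in> left_perp C T"
    using obtain_torsion_epimorphism[OF X m] .
  show "Y \<in> left_perp C T"
    by (rule mp[OF Y torsion_epimorphism_stable(3)[OF t assms[OF t]]])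
qed

lemma balanced_iff_closed: "balanced S \<longleftrightarrow> closed_under_subobjects C (left_perp C T)"
proof
  assume "balanced S"
  then show "closed_under_subobjects C (left_perp C T)"
    using torsion_epimorphism_stable(1,2) unfolding balanced_def
    by (intro closed_if_torsion_epimorphisms_iso) blast
qed (rule balanced_if_closed)

lemma closed_if_weakly_balanced:
  assumes data: "suspension_data C T i c" "loop_data C T p l" and wb: "weakly_balanced C T i c p l"
  shows "closed_under_subobjects C (left_perp C T)"
proof (rule closed_if_torsion_epimorphisms_iso)
  fix N Z F \<pi> k assume t: "\<pi> \<in> Hom C N Z" "epic C \<pi>" "k \<in> Hom C F N" "is_kernel C \<pi> k" "F \<in> T"
    "N \<in> left_perp C T"
  have "cls \<pi> \<in> Arr S" using stable_HomI[OF t(1)] by (simp add: Hom_def)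
  then show "iso_arr S (cls \<pi>)"
    using wb right_triangle_on_left_perp[OF data(1) t(1,2,6)]
      left_triangle_on_epimorphism[OF data(2) t(1,2,3,4,5)]
    unfolding weakly_balanced_def Let_def by blast
qed

end

theorem proposition2p5p8:
  fixes H :: "('o, 'm) cat" and T :: "'o set"
  assumes "abelian_category H"
    and "\<And>P Q. projective H P \<Longrightarrow> subobject H Q P \<Longrightarrow> projective H Q"
    and "additive_subcategory H T"
    and "closed_under_summands H T"
    and "\<And>P. P \<in> T \<Longrightarrow> projective H P"
    and "covariantly_finite H T"
  shows "(balanced (stable_category H T) \<longleftrightarrow> closed_under_subobjects H (left_perp H T)) \<and>
    (balanced (stable_category H T) \<longleftrightarrow>
       hereditary_torsion_pair H (left_perp H T) (Sub H T)) \<and>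
    (balanced (stable_category H T) \<longleftrightarrow>
       hereditary_torsion_pair H (left_perp H T) (Sub H T) \<and>
       split_torsion_pair H (left_perp H T) (Sub H T)) \<and>
    (contravariantly_finite H T \<longrightarrow>
       (\<forall>i c p k. suspension_data H T i c \<and> loop_data H T p k \<longrightarrow>
          (balanced (stable_category H T) \<longleftrightarrow> weakly_balanced H T i c p k))) \<and>
    (enough_injectives H \<longrightarrow>
       (balanced (stable_category H T) \<longleftrightarrow>
          (\<forall>X \<in> T. \<exists>E \<in> T. injective H E \<and> subobject H X E)) \<and>
       (balanced (stable_category H T) \<longleftrightarrow>
          (\<forall>X \<in> T. \<exists>E \<in> T. injective H E \<and> projective H E \<and> subobject H X E)))"
proof -
  interpret covariantly_finite_projectives H T
    using assms by (intro covariantly_finite_projectives.intro covariantly_finite_projectives_axioms.intro)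
  note closed = balanced_iff_closed
  have hereditary: "balanced S \<longleftrightarrow> hereditary_torsion_pair H (left_perp H T) (Sub H T)"
    using closed torsion_pair_left_perp_Sub unfolding hereditary_torsion_pair_def by blast
  have weak: "balanced S \<longleftrightarrow> weakly_balanced H T i c p k"
    if "suspension_data H T i c" "loop_data H T p k" for i c p k
    using that closed closed_if_weakly_balanced weakly_balanced_if_balanced by blast
  have injectives: "balanced S \<longleftrightarrow> (\<forall>X \<in> T. \<exists>E \<in> T. injective H E \<and> subobject H X E)"
    if "enough_injectives H"
    using closed closed_if_embeds_in_injective embeds_in_injective_if_closed that by blast
  show ?thesis
    using closed hereditary split_torsion_pair_left_perp_Sub weak injectives T_projective by blast
qed

end
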